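(* Let $m,r$ be positive integers and $d$ a nonnegative integer. (i) If $P(\lambda)\in\mathrm{POL}^{ss}_{d,2r,m}$ and $\operatorname{rank}(P)=2r$, then $P(\lambda)=L(\lambda)E(\lambda)L(\lambda)^T$, where the columns of $L(\lambda)\in\mathrm{POL}^{m\times 2r}$ form a minimal basis of $\mathcal{C}ol(P)$ and $E(\lambda)\in\mathrm{POL}^{2r\times 2r}$ is skew-symmetric with $\operatorname{rank}(E)=2r$. (ii) If $P(\lambda)\in\mathrm{POL}^{ss}_{d,2r,m}$, $\operatorname{rank}(P)=2r$, $\deg(P)=d$, $P(\lambda)$ has no eigenvalues (finite or infinite), and the columns of $L(\lambda)$ in the factorization in item (i) are ordered in such a way that $\deg(L_{*1})\ge\deg(L_{*2})\ge\cdots\ge\deg(L_{*2r})$, then $$\deg(L_{*i})+\deg(L_{*(2r-i+1)})=d,\quad \text{for } i=1,\ldots,2r.$$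
   Context: All matrix polynomials have coefficients in $\mathbb{C}$. $\mathrm{POL}^{p\times q}$ is the set of all $p\times q$ matrix polynomials. The degree of a matrix polynomial is the largest power of $\lambda$ with a nonzero matrix coefficient. $L_{*i}$ is the $i$-th column of $L(\lambda)$. The (normal) rank of a matrix polynomial is its rank over the field $\mathbb{C}(\lambda)$. $\mathrm{POL}^{ss}_{d,2r,m}$ is the set of $m\times m$ skew-symmetric matrix polynomials $P(\lambda)=\sum_{i=0}^d\lambda^iA_i$ ($A_i\in\mathbb{C}^{m\times m}$, $A_i^T=-A_i$) of degree at most $d$ and normal rank at most $2r$. $\mathcal{C}ol(P)$ is the rational column space of $P$, i.e. the subspace of $\mathbb{C}(\lambda)^m$ spanned over $\mathbb{C}(\lambda)$ by the columns of $P(\lambda)$. A minimal basis of a subspace $\mathcal{V}\subseteq\mathbb{C}(\lambda)^m$ is a basis of $\mathcal{V}$ consisting of vector polynomials whose sum of degrees is minimal among all bases of $\mathcal{V}$ consisting of vector polynomials. Eigenvalues: $\alpha\in\mathbb{C}$ is a finite eigenvalue of $P(\lambda)$ if it is a root of at least one of the invariant polynomials of $P(\lambda)$ (the nonzero diagonal entries of its Smith form over $\mathbb{C}[\lambda]$); equivalently, $\operatorname{rank}P(\alpha)<\operatorname{rank}(P)$. $\infty$ is an eigenvalue of $P(\lambda)$, regarded as a polynomial of grade $d$, if $0$ is an eigenvalue of $\mathrm{rev}_dP(\lambda):=\lambda^dP(1/\lambda)$. *)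

theory Defs
  imports
    "Jordan_Normal_Form.DL_Rank"
    "HOL-Computational_Algebra.Polynomial_Factorial"
begin

text \<open>
  Matrix and vector polynomials are matrices and vectors over \<^typ>\<open>complex poly\<close>; the field of
  rational functions is \<^typ>\<open>complex poly fract\<close>, with embedding \<^const>\<open>to_fract\<close>.  Rows and
  columns are indexed from 0.
\<close>

definition mat_coeff :: "complex poly mat \<Rightarrow> nat \<Rightarrow> complex mat" where
  "mat_coeff A k = map_mat (\<lambda>p. coeff p k) A"

definition vec_coeff :: "complex poly vec \<Rightarrow> nat \<Rightarrow> complex vec" where
  "vec_coeff v k = map_vec (\<lambda>p. coeff p k) v"

text \<open>As for \<^const>\<open>degree\<close>, the degree of the zero matrix or vector is taken to be 0.\<close>

definition mat_degree :: "complex poly mat \<Rightarrow> nat" where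
  "mat_degree A = Max (insert 0 {k. mat_coeff A k \<noteq> 0\<^sub>m (dim_row A) (dim_col A)})"

definition vec_degree :: "complex poly vec \<Rightarrow> nat" where
  "vec_degree v = Max (insert 0 {k. vec_coeff v k \<noteq> 0\<^sub>v (dim_vec v)})"

lemma finite_mat_coeff_nonzero:
  "finite {k. mat_coeff A k \<noteq> 0\<^sub>m (dim_row A) (dim_col A)}"
proof -
  have "{k. mat_coeff A k \<noteq> 0\<^sub>m (dim_row A) (dim_col A)}
      \<subseteq> (\<Union>i<dim_row A. \<Union>j<dim_col A. {..degree (A $$ (i, j))})"
    by (auto simp: mat_coeff_def mat_eq_iff intro!: le_degree)
  then show ?thesis
    by (rule finite_subset) auto
qed

lemma finite_vec_coeff_nonzero: "finite {k. vec_coeff v k \<noteq> 0\<^sub>v (dim_vec v)}"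
proof -
  have "{k. vec_coeff v k \<noteq> 0\<^sub>v (dim_vec v)} \<subseteq> (\<Union>i<dim_vec v. {..degree (v $ i)})"
    by (auto simp: vec_coeff_def vec_eq_iff intro!: le_degree)
  then show ?thesis
    by (rule finite_subset) auto
qed

abbreviation fract_mat :: "complex poly mat \<Rightarrow> complex poly fract mat" where
  "fract_mat \<equiv> map_mat to_fract"

abbreviation fract_vec :: "complex poly vec \<Rightarrow> complex poly fract vec" where
  "fract_vec \<equiv> map_vec to_fract"

definition normal_rank :: "complex poly mat \<Rightarrow> nat" where
  "normal_rank A = vec_space.rank (dim_row A) (fract_mat A)"

definition Col :: "complex poly mat \<Rightarrow> complex poly fract vec set" where
  "Col A = vec_space.col_space (dim_row A) (fract_mat A)"

definition skew_symmetric_matpoly :: "complex poly mat \<Rightarrow> bool" where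
  "skew_symmetric_matpoly A \<longleftrightarrow> square_mat A \<and> (\<forall>k. (mat_coeff A k)\<^sup>T = - mat_coeff A k)"

text \<open>\<open>POL_ss d k m\<close>: skew-symmetric, size \<open>m\<close>, degree at most \<open>d\<close>, rank at most \<open>k\<close>.\<close>

definition POL_ss :: "nat \<Rightarrow> nat \<Rightarrow> nat \<Rightarrow> complex poly mat set" where
  "POL_ss d k m = {P \<in> carrier_mat m m.
     skew_symmetric_matpoly P \<and> mat_degree P \<le> d \<and> normal_rank P \<le> k}"

definition (in vec_space) basis_of :: "'a vec set \<Rightarrow> 'a vec set \<Rightarrow> bool" where
  "basis_of W B \<longleftrightarrow> B \<subseteq> carrier_vec n \<and> lin_indpt B \<and> span B = W"

text \<open>
  Bases are lists, so that the columns of a matrix can form one; \<open>m\<close> is the dimension of the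
  ambient space containing \<open>V\<close>.
\<close>

definition polynomial_basis ::
  "nat \<Rightarrow> complex poly fract vec set \<Rightarrow> complex poly vec list \<Rightarrow> bool" where
  "polynomial_basis m V bs \<longleftrightarrow> distinct bs \<and> vec_space.basis_of m V (fract_vec ` set bs)"

definition minimal_basis ::
  "nat \<Rightarrow> complex poly fract vec set \<Rightarrow> complex poly vec list \<Rightarrow> bool" where
  "minimal_basis m V bs \<longleftrightarrow> polynomial_basis m V bs \<and>
     (\<forall>cs. polynomial_basis m V cs \<longrightarrow>
        (\<Sum>b\<leftarrow>bs. vec_degree b) \<le> (\<Sum>c\<leftarrow>cs. vec_degree c))"

text \<open>
  Over \<^typ>\<open>complex poly\<close>, \<^const>\<open>invertible_mat\<close> means unimodular.  The divisibility chain puts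
  the zero diagonal entries last.
\<close>

definition smith_form :: "complex poly mat \<Rightarrow> complex poly mat \<Rightarrow> bool" where
  "smith_form A S \<longleftrightarrow>
     S \<in> carrier_mat (dim_row A) (dim_col A) \<and>
     (\<exists>U V. U \<in> carrier_mat (dim_row A) (dim_row A) \<and> V \<in> carrier_mat (dim_col A) (dim_col A) \<and>
        invertible_mat U \<and> invertible_mat V \<and> S = U * A * V) \<and>
     diagonal_mat S \<and>
     (\<forall>i < min (dim_row S) (dim_col S). S $$ (i, i) \<noteq> 0 \<longrightarrow> lead_coeff (S $$ (i, i)) = 1) \<and>
     (\<forall>i. Suc i < min (dim_row S) (dim_col S) \<longrightarrow> S $$ (i, i) dvd S $$ (Suc i, Suc i))"

definition invariant_polynomial :: "complex poly mat \<Rightarrow> complex poly \<Rightarrow> bool" where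
  "invariant_polynomial A p \<longleftrightarrow>
     (\<exists>S i. smith_form A S \<and> i < min (dim_row S) (dim_col S) \<and> p = S $$ (i, i) \<and> p \<noteq> 0)"

definition finite_eigenvalue :: "complex poly mat \<Rightarrow> complex \<Rightarrow> bool" where
  "finite_eigenvalue A \<alpha> \<longleftrightarrow> (\<exists>p. invariant_polynomial A p \<and> poly p \<alpha> = 0)"

definition rev_poly :: "nat \<Rightarrow> complex poly \<Rightarrow> complex poly" where
  "rev_poly d p = (\<Sum>i\<le>d. monom (coeff p i) (d - i))"

lemma poly_rev_poly:
  assumes "degree p \<le> d" "x \<noteq> 0"
  shows "poly (rev_poly d p) x = x ^ d * poly p (1 / x)"
proof -
  have "poly p (1 / x) = (\<Sum>i\<le>d. coeff p i * (1 / x) ^ i)"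
    unfolding poly_altdef using assms(1)
    by (intro sum.mono_neutral_left) (auto simp: coeff_eq_0)
  then show ?thesis
    using assms(2)
    by (auto simp: rev_poly_def poly_sum poly_monom sum_distrib_left power_diff power_divide
        field_simps intro!: sum.cong)
qed

definition rev_mat :: "nat \<Rightarrow> complex poly mat \<Rightarrow> complex poly mat" where
  "rev_mat d A = map_mat (rev_poly d) A"

definition infinite_eigenvalue :: "nat \<Rightarrow> complex poly mat \<Rightarrow> bool" where
  "infinite_eigenvalue d A \<longleftrightarrow> finite_eigenvalue (rev_mat d A) 0"

definition skew_factorization ::
  "nat \<Rightarrow> nat \<Rightarrow> complex poly mat \<Rightarrow> complex poly mat \<Rightarrow> complex poly mat \<Rightarrow> bool" where
  "skew_factorization m r P L E \<longleftrightarrow>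
     L \<in> carrier_mat m (2 * r) \<and> E \<in> carrier_mat (2 * r) (2 * r) \<and>
     P = L * E * L\<^sup>T \<and>
     minimal_basis m (Col P) (cols L) \<and>
     skew_symmetric_matpoly E \<and> normal_rank E = 2 * r"

end

theory Submission
  imports
    Defs
    "Subresultants.More_Homomorphisms"
    "HOL-Computational_Algebra.Fundamental_Theorem_Algebra"
begin

text \<open>
  A minimal basis \<open>L\<close> has a polynomial left inverse \<open>G\<close>: its Smith form has only unit invariant
  polynomials, since a root \<open>\<alpha>\<close> would make \<open>L(\<alpha>)\<close> rank deficient and a column of \<open>L\<close> could be
  exchanged for one of lower degree.  As the columns of \<open>P\<close>, and by skew-symmetry its rows, lie in
  the span of \<open>L\<close>, the matrix \<open>E = G P G\<^sup>T\<close> gives \<open>P = L E L\<^sup>T\<close>.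

  For the degrees \<open>\<delta>\<^sub>i\<close> of the columns of \<open>L\<close>, the predictable degree property gives
  \<open>\<delta>\<^sub>i + \<delta>\<^sub>j + deg E\<^sub>i\<^sub>j \<le> d\<close> whenever \<open>E\<^sub>i\<^sub>j \<noteq> 0\<close>.  Absence of finite eigenvalues makes \<open>det E\<close> a
  nonzero constant; absence of an infinite one makes the coefficient of \<open>det E\<close> at the exponent
  \<open>2 r d - 2 \<Sum> \<delta>\<^sub>i\<close> nonzero, so \<open>\<Sum> \<delta>\<^sub>i = r d\<close>.  A nonzero term in the Leibniz expansion of \<open>det E\<close>
  and the ordering of the degrees give \<open>\<delta>\<^sub>i + \<delta>\<^bsub>2r-i+1\<^esub> \<le> d\<close>, and summation forces equality.
\<close>

section \<open>Smith normal form\<close>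

lemma invertible_mat_iff_det_dvd_1:
  assumes A: "A \<in> carrier_mat n n"
  shows "invertible_mat A \<longleftrightarrow> det (A :: 'a :: comm_ring_1 mat) dvd 1"
proof
  assume "invertible_mat A"
  then obtain B where AB: "A * B = 1\<^sub>m n" and BA: "B * A = 1\<^sub>m (dim_row B)"
    using A unfolding invertible_mat_def inverts_mat_def by auto
  have B: "B \<in> carrier_mat n n"
    using arg_cong[OF AB, of dim_col] arg_cong[OF BA, of dim_col] A by auto
  show "det A dvd 1"
    using det_mult[OF A B] AB by (metis det_one dvd_triv_left)
next
  assume "det A dvd 1"
  then obtain c where c: "1 = det A * c" by (elim dvdE)
  let ?B = "c \<cdot>\<^sub>m adj_mat A"
  have "A * ?B = 1\<^sub>m n" "?B * A = 1\<^sub>m n"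
    using adj_mat[OF A] A c
    by (auto simp: mult_smult_distrib[OF A adj_mat(1)[OF A]] mult_smult_assoc_mat[OF adj_mat(1)[OF A] A]
        mult.commute intro!: eq_matI)
  then show "invertible_mat A"
    using A adj_mat(1)[OF A] unfolding invertible_mat_def inverts_mat_def
    by (intro conjI exI[of _ ?B]) auto
qed

lemma unimodular_inverse:
  assumes A: "A \<in> carrier_mat n n" and "det (A :: 'a :: comm_ring_1 mat) dvd 1"
  obtains B where "B \<in> carrier_mat n n" "A * B = 1\<^sub>m n" "B * A = 1\<^sub>m n"
proof -
  have "invertible_mat A" using assms invertible_mat_iff_det_dvd_1 by blast
  then obtain B where AB: "A * B = 1\<^sub>m n" and BA: "B * A = 1\<^sub>m (dim_row B)"
    using A unfolding invertible_mat_def inverts_mat_def by auto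
  have B: "B \<in> carrier_mat n n"
    using arg_cong[OF AB, of dim_col] arg_cong[OF BA, of dim_col] A by auto
  then show ?thesis using that AB BA by auto
qed

definition mat_equiv :: "'a :: comm_ring_1 mat \<Rightarrow> 'a mat \<Rightarrow> bool" where
  "mat_equiv A B \<longleftrightarrow> (\<exists>U V. U \<in> carrier_mat (dim_row A) (dim_row A) \<and>
     V \<in> carrier_mat (dim_col A) (dim_col A) \<and> det U dvd 1 \<and> det V dvd 1 \<and> B = U * A * V)"

lemma mat_equivI:
  assumes "A \<in> carrier_mat a b" "U \<in> carrier_mat a a" "V \<in> carrier_mat b b"
    "det U dvd 1" "det V dvd 1" "B = U * A * V"
  shows "mat_equiv A B"
  unfolding mat_equiv_def using assms by (intro exI[of _ U] exI[of _ V]) auto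

lemma mat_equivE:
  assumes "mat_equiv A B" "A \<in> carrier_mat a b"
  obtains U V where "U \<in> carrier_mat a a" "V \<in> carrier_mat b b"
    "det U dvd 1" "det V dvd 1" "B = U * A * V"
  using assms unfolding mat_equiv_def by auto

lemma mat_equiv_carrier:
  "mat_equiv A B \<Longrightarrow> A \<in> carrier_mat a b \<Longrightarrow> B \<in> carrier_mat a b"
  by (erule mat_equivE) auto

lemma mat_equiv_mult_left:
  assumes "A \<in> carrier_mat a b" "U \<in> carrier_mat a a" "det U dvd 1"
  shows "mat_equiv A (U * A)"
  using assms by (intro mat_equivI[of A a b U "1\<^sub>m b"]) auto

lemma mat_equiv_mult_right:
  assumes "A \<in> carrier_mat a b" "V \<in> carrier_mat b b" "det V dvd 1"
  shows "mat_equiv A (A * V)"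
  using assms by (intro mat_equivI[of A a b "1\<^sub>m a" V]) auto

lemma mat_equiv_refl: "mat_equiv A A"
  using mat_equiv_mult_left[of A "dim_row A" "dim_col A" "1\<^sub>m (dim_row A)"] by auto

lemma mat_equiv_trans:
  assumes "mat_equiv A B" "mat_equiv B C"
  shows "mat_equiv A C"
proof -
  define a b where "a = dim_row A" and "b = dim_col A"
  have A: "A \<in> carrier_mat a b" by (simp add: a_def b_def)
  obtain U V where UV: "U \<in> carrier_mat a a" "V \<in> carrier_mat b b" "det U dvd 1" "det V dvd 1"
    "B = U * A * V" using mat_equivE[OF assms(1) A] by blast
  obtain U' V' where UV': "U' \<in> carrier_mat a a" "V' \<in> carrier_mat b b" "det U' dvd 1" "det V' dvd 1"
    "C = U' * B * V'" using mat_equivE[OF assms(2) mat_equiv_carrier[OF assms(1) A]] by blast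
  show ?thesis
  proof (rule mat_equivI[OF A, of "U' * U" "V * V'"])
    show "det (U' * U) dvd 1" "det (V * V') dvd 1"
      using UV UV' mult_dvd_mono[of "det U'" 1 "det U" 1] mult_dvd_mono[of "det V" 1 "det V'" 1]
      by (simp_all add: det_mult)
    show "C = U' * U * A * (V * V')"
      using A UV UV' by (simp add: assoc_mult_mat[of _ a a _ a _ b] assoc_mult_mat[of _ a a _ b _ b]
          assoc_mult_mat[of _ a b _ b _ b])
  qed (use UV UV' in auto)
qed

lemma mat_equiv_transpose:
  assumes "mat_equiv A B" shows "mat_equiv A\<^sup>T B\<^sup>T"
proof -
  define a b where "a = dim_row A" and "b = dim_col A"
  have A: "A \<in> carrier_mat a b" by (simp add: a_def b_def)
  obtain U V where UV: "U \<in> carrier_mat a a" "V \<in> carrier_mat b b" "det U dvd 1" "det V dvd 1"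
    "B = U * A * V" using mat_equivE[OF assms(1) A] by blast
  show ?thesis
    using A UV by (intro mat_equivI[of _ b a "V\<^sup>T" "U\<^sup>T"])
      (auto simp: det_transpose transpose_mult[of _ a b _ b] transpose_mult[of _ a a _ b]
        assoc_mult_mat[of _ b b _ a _ a])
qed

lemma mat_equiv_swaprows:
  assumes "A \<in> carrier_mat a b" "k < a" "l < a"
  shows "mat_equiv A (swaprows k l A)"
proof (cases "k = l")
  case True
  then have "swaprows k l A = A" using assms by auto
  then show ?thesis by (simp add: mat_equiv_refl)
next
  case False
  then show ?thesis using assms
    by (auto simp: swaprows_mat[OF assms] det_swaprows_mat intro!: mat_equiv_mult_left)
qed

lemma mat_equiv_addrow:
  assumes "A \<in> carrier_mat a b" "k \<noteq> l" "l < a"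
  shows "mat_equiv A (addrow c k l A)"
  using assms unfolding addrow_mat[OF assms(1,3)]
  by (intro mat_equiv_mult_left[of _ a b]) (auto simp: det_addrow_mat)

lemma mat_equiv_clear_col:
  fixes A :: "'a :: euclidean_ring mat"
  assumes A: "A \<in> carrier_mat a b" and "0 < a" "0 < b" and dvd: "\<forall>i<a. A $$ (0, 0) dvd A $$ (i, 0)"
  obtains B where "mat_equiv A B" "\<forall>j<b. B $$ (0, j) = A $$ (0, j)" "\<forall>i<a. 0 < i \<longrightarrow> B $$ (i, 0) = 0"
proof -
  define U where "U = mat a a (\<lambda>(i, j). if i = j then 1 else if j = 0
    then - (A $$ (i, 0) div A $$ (0, 0)) else 0)"
  have U: "U \<in> carrier_mat a a" by (simp add: U_def)
  have "det U = prod_list (diag_mat U)"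
    by (rule det_lower_triangular[OF _ U]) (auto simp: U_def)
  also have "\<dots> = 1" unfolding prod_list_diag_prod by (rule prod.neutral) (auto simp: U_def)
  finally have det: "det U = 1" .
  have entry: "(U * A) $$ (i, j) = A $$ (i, j) - (if i = 0 then 0 else A $$ (i, 0) div A $$ (0, 0) * A $$ (0, j))"
    if ij: "i < a" "j < b" for i j
  proof -
    have "(U * A) $$ (i, j) = (\<Sum>k = 0..<a. U $$ (i, k) * A $$ (k, j))"
      using ij A U by (auto simp: scalar_prod_def)
    also have "\<dots> = (\<Sum>k = 0..<a. (if k = i then A $$ (i, j) else 0) +
      (if k = 0 then if i = 0 then 0 else - (A $$ (i, 0) div A $$ (0, 0) * A $$ (0, j)) else 0))"
      using ij by (intro sum.cong) (auto simp: U_def)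
    finally show ?thesis using ij by (simp add: sum.distrib)
  qed
  show ?thesis
  proof (rule that[of "U * A"])
    show "mat_equiv A (U * A)" using A U det by (intro mat_equiv_mult_left[of _ a b]) auto
    show "\<forall>j<b. (U * A) $$ (0, j) = A $$ (0, j)"
      using entry \<open>0 < a\<close> by auto
    show "\<forall>i<a. 0 < i \<longrightarrow> (U * A) $$ (i, 0) = 0"
      using entry dvd \<open>0 < b\<close> by auto
  qed
qed

lemma mat_equiv_pivot:
  fixes A :: "'a :: euclidean_ring mat"
  assumes A: "A \<in> carrier_mat a b" and nz: "A \<noteq> 0\<^sub>m a b"
  obtains B where "mat_equiv A B" "\<forall>i<a. 0 < i \<longrightarrow> B $$ (i, 0) = 0" "\<forall>j<b. 0 < j \<longrightarrow> B $$ (0, j) = 0"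
    "\<forall>i<a. \<forall>j<b. B $$ (0, 0) dvd B $$ (i, j)"
proof -
  define minimal where "minimal = (\<lambda>A :: 'a mat. \<lambda>e. \<forall>B i j. mat_equiv A B \<longrightarrow>
    i < dim_row A \<longrightarrow> j < dim_col A \<longrightarrow> B $$ (i, j) \<noteq> 0 \<longrightarrow> e \<le> euclidean_size (B $$ (i, j)))"
  have min_trans: "minimal A' e" if "minimal A e" "mat_equiv A A'" for A A' e
  proof -
    have "A' \<in> carrier_mat (dim_row A) (dim_col A)"
      using mat_equiv_carrier[OF that(2)] by auto
    then have "dim_row A' = dim_row A" "dim_col A' = dim_col A" by auto
    then show ?thesis
      using that(1) mat_equiv_trans[OF that(2)] unfolding minimal_def by simp
  qed
  have min_transpose: "minimal A\<^sup>T e" if "minimal A e" for A e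
    unfolding minimal_def
  proof (intro allI impI)
    fix B i j assume B: "mat_equiv A\<^sup>T B" and ij: "i < dim_row A\<^sup>T" "j < dim_col A\<^sup>T" and nz: "B $$ (i, j) \<noteq> 0"
    have "mat_equiv A B\<^sup>T" using mat_equiv_transpose[OF B] by simp
    moreover have "B\<^sup>T $$ (j, i) = B $$ (i, j)"
      using mat_equiv_carrier[OF B, of "dim_col A" "dim_row A"] ij by auto
    ultimately show "e \<le> euclidean_size (B $$ (i, j))"
      using that ij nz unfolding minimal_def by (metis index_transpose_mat(2,3))
  qed
  have col_dvd: "A $$ (0, 0) dvd A $$ (i, 0)"
    if A: "A \<in> carrier_mat a b" "minimal A (euclidean_size (A $$ (0, 0)))" and p: "A $$ (0, 0) \<noteq> 0" and ib: "i < a" "0 < b"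
    for A :: "'a mat" and a b i
  proof (rule ccontr)
    assume ndvd: "\<not> ?thesis"
    then have i: "i \<noteq> 0" by (metis dvd_refl)
    let ?c = "- (A $$ (i, 0) div A $$ (0, 0))"
    have "mat_equiv A (addrow ?c i 0 A)"
      using A ib i by (intro mat_equiv_addrow[of _ a b]) auto
    moreover have "addrow ?c i 0 A $$ (i, 0) = A $$ (i, 0) mod A $$ (0, 0)"
      using A ib i by (auto simp: minus_div_mult_eq_mod[symmetric])
    moreover have "A $$ (i, 0) mod A $$ (0, 0) \<noteq> 0"
      using ndvd by (simp add: dvd_eq_mod_eq_0)
    ultimately have "euclidean_size (A $$ (0, 0)) \<le> euclidean_size (A $$ (i, 0) mod A $$ (0, 0))"
      using A ib unfolding minimal_def by (metis carrier_matD)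
    then show False using mod_size_less[OF p, of "A $$ (i, 0)"] by simp
  qed
  obtain X where X: "mat_equiv A X" "X $$ (0, 0) \<noteq> 0" "minimal A (euclidean_size (X $$ (0, 0)))"
    and ab: "0 < a" "0 < b"
  proof -
    define Q where "Q = (\<lambda>(B, i, j). mat_equiv A B \<and> i < a \<and> j < b \<and> B $$ (i, j) \<noteq> 0)"
    obtain i j where "i < a" "j < b" "A $$ (i, j) \<noteq> 0"
      using nz A by (auto simp: mat_eq_iff)
    then have "Q (A, i, j)" by (simp add: Q_def mat_equiv_refl)
    from ex_has_least_nat[of Q, OF this, of "\<lambda>(B, i, j). euclidean_size (B $$ (i, j))"]
    obtain B k l where Q: "Q (B, k, l)"
      and least: "\<And>C i j. Q (C, i, j) \<Longrightarrow> euclidean_size (B $$ (k, l)) \<le> euclidean_size (C $$ (i, j))"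
      by auto
    have B: "mat_equiv A B" "k < a" "l < b" "B $$ (k, l) \<noteq> 0" using Q by (auto simp: Q_def)
    have Bc: "B \<in> carrier_mat a b" using mat_equiv_carrier[OF B(1) A] .
    define C where "C = swaprows 0 k B"
    define D where "D = (swaprows 0 l C\<^sup>T)\<^sup>T"
    have Cc: "C \<in> carrier_mat a b" using Bc by (simp add: C_def)
    have BC: "mat_equiv B C" unfolding C_def using Bc B by (intro mat_equiv_swaprows[of _ a b]) auto
    have "mat_equiv C\<^sup>T (swaprows 0 l C\<^sup>T)"
      using Cc B by (intro mat_equiv_swaprows[of _ b a]) auto
    from mat_equiv_transpose[OF this] have CD: "mat_equiv C D" by (simp add: D_def)
    have D00: "D $$ (0, 0) = B $$ (k, l)"
      using B Bc by (auto simp: C_def D_def)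
    show ?thesis
    proof (rule that[of D])
      show "mat_equiv A D" using B(1) BC CD mat_equiv_trans by blast
      show "D $$ (0, 0) \<noteq> 0" using B D00 by simp
      show "minimal A (euclidean_size (D $$ (0, 0)))"
        unfolding minimal_def D00 using least A by (auto simp: Q_def)
    qed (use B in auto)
  qed
  have Xc: "X \<in> carrier_mat a b" using mat_equiv_carrier[OF X(1) A] .
  let ?e = "euclidean_size (X $$ (0, 0))"
  obtain Y where Y: "mat_equiv X Y" "\<forall>j<b. Y $$ (0, j) = X $$ (0, j)" "\<forall>i<a. 0 < i \<longrightarrow> Y $$ (i, 0) = 0"
    using mat_equiv_clear_col[OF Xc ab] col_dvd[OF Xc min_trans[OF X(3,1)] X(2)] ab by metis
  have Yc: "Y \<in> carrier_mat a b" using mat_equiv_carrier[OF Y(1) Xc] .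
  have AY: "mat_equiv A Y" using X Y mat_equiv_trans by blast
  have Y00: "Y $$ (0, 0) = X $$ (0, 0)" using Y ab by auto
  have YTc: "Y\<^sup>T \<in> carrier_mat b a" using Yc by auto
  have "minimal Y\<^sup>T (euclidean_size (Y\<^sup>T $$ (0, 0)))"
    using min_transpose[OF min_trans[OF X(3) AY]] Y00 Yc ab by auto
  moreover have "Y\<^sup>T $$ (0, 0) \<noteq> 0" using X(2) Y00 Yc ab by auto
  ultimately have "\<forall>i<b. Y\<^sup>T $$ (0, 0) dvd Y\<^sup>T $$ (i, 0)" using col_dvd[OF YTc] ab by blast
  then obtain Z where Z: "mat_equiv Y\<^sup>T Z" "\<forall>j<a. Z $$ (0, j) = Y\<^sup>T $$ (0, j)" "\<forall>i<b. 0 < i \<longrightarrow> Z $$ (i, 0) = 0"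
    by (rule mat_equiv_clear_col[OF YTc ab(2,1)])
  define B where "B = Z\<^sup>T"
  have "mat_equiv Y B" using mat_equiv_transpose[OF Z(1)] by (simp add: B_def)
  then have AB: "mat_equiv A B" using AY mat_equiv_trans by blast
  then have Bc: "B \<in> carrier_mat a b" using mat_equiv_carrier A by blast
  have Zc: "Z \<in> carrier_mat b a" using mat_equiv_carrier[OF Z(1) YTc] .
  have B00: "B $$ (0, 0) = X $$ (0, 0)" using Z(2) Zc Yc ab Y00 by (auto simp: B_def)
  have Bcol: "\<forall>i<a. 0 < i \<longrightarrow> B $$ (i, 0) = 0" using Z(2) Zc Yc ab Y(3) by (auto simp: B_def)
  have Brow: "\<forall>j<b. 0 < j \<longrightarrow> B $$ (0, j) = 0" using Z(3) Zc ab by (auto simp: B_def)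
  have row_dvd: "X $$ (0, 0) dvd W $$ (0, j)"
    if W: "mat_equiv A W" "W $$ (0, 0) = X $$ (0, 0)" and j: "j < b" for W j
  proof -
    have Wc: "W \<in> carrier_mat a b" using mat_equiv_carrier[OF W(1) A] .
    then have WTc: "W\<^sup>T \<in> carrier_mat b a" by auto
    have "minimal W\<^sup>T (euclidean_size (W\<^sup>T $$ (0, 0)))"
      using min_transpose[OF min_trans[OF X(3) W(1)]] W(2) Wc ab by auto
    moreover have "W\<^sup>T $$ (0, 0) \<noteq> 0" using X(2) W(2) Wc ab by auto
    ultimately have "W\<^sup>T $$ (0, 0) dvd W\<^sup>T $$ (j, 0)" using col_dvd[OF WTc] ab j by blast
    then show ?thesis using Wc ab j W(2) by auto
  qed
  show ?thesis
  proof (rule that[OF AB Bcol Brow], intro allI impI)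
    fix i j assume ij: "i < a" "j < b"
    show "B $$ (0, 0) dvd B $$ (i, j)"
    proof (cases "i = 0")
      case True then show ?thesis using row_dvd[OF AB B00 ij(2)] B00 by simp
    next
      case False
      let ?W = "addrow 1 0 i B"
      have BW: "mat_equiv B ?W" using Bc ij False by (intro mat_equiv_addrow[of _ a b]) auto
      have W00: "?W $$ (0, 0) = X $$ (0, 0)" using Bcol Bc ij ab False B00 by auto
      have "X $$ (0, 0) dvd ?W $$ (0, j)"
        using row_dvd[OF mat_equiv_trans[OF AB BW] W00 ij(2)] .
      moreover have "?W $$ (0, j) = B $$ (i, j) + B $$ (0, j)" using Bc ij ab by auto
      moreover have "X $$ (0, 0) dvd B $$ (0, j)" using row_dvd[OF AB B00 ij(2)] .
      ultimately show ?thesis using B00 by (simp add: dvd_add_left_iff)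
    qed
  qed
qed

lemma dvd_mat_mult_left:
  assumes "C \<in> carrier_mat a b" "U \<in> carrier_mat c a"
    and "\<forall>i<a. \<forall>j<b. (p :: 'a :: comm_ring_1) dvd C $$ (i, j)"
  shows "\<forall>i<c. \<forall>j<b. p dvd (U * C) $$ (i, j)"
  using assms by (auto simp: scalar_prod_def intro!: dvd_sum)

lemma dvd_mat_mult_right:
  assumes "C \<in> carrier_mat a b" "V \<in> carrier_mat b c"
    and "\<forall>i<a. \<forall>j<b. (p :: 'a :: comm_ring_1) dvd C $$ (i, j)"
  shows "\<forall>i<a. \<forall>j<c. p dvd (C * V) $$ (i, j)"
  using assms by (auto simp: scalar_prod_def intro!: dvd_sum)

abbreviation bordered :: "'a :: comm_ring_1 \<Rightarrow> 'a mat \<Rightarrow> 'a mat" where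
  "bordered p C \<equiv> four_block_mat (mat 1 1 (\<lambda>_. p)) (0\<^sub>m 1 (dim_col C)) (0\<^sub>m (dim_row C) 1) C"

lemma bordered_mult:
  assumes "C \<in> carrier_mat a b" "D \<in> carrier_mat b c"
  shows "bordered p C * bordered q D = bordered (p * q) (C * D)"
proof -
  have "mat 1 1 (\<lambda>_. p) * mat 1 1 (\<lambda>_. q) = mat 1 1 (\<lambda>_. p * q)"
    by (rule eq_matI) (auto simp: scalar_prod_def)
  then show ?thesis
    using assms mult_four_block_mat[of "mat 1 1 (\<lambda>_. p)" 1 1 "0\<^sub>m 1 b" b "0\<^sub>m a 1" a C
        "mat 1 1 (\<lambda>_. q)" 1 "0\<^sub>m 1 c" c "0\<^sub>m b 1" D]
    by (simp add: left_add_zero_mat[of _ 1 1] left_add_zero_mat[of _ a c] right_add_zero_mat[of _ 1 1])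
qed

lemma det_bordered:
  assumes "(C :: 'a :: idom mat) \<in> carrier_mat a a"
  shows "det (bordered p C) = p * det C"
  using assms det_four_block_mat_upper_right_zero[of "mat 1 1 (\<lambda>_. p)" 1 "0\<^sub>m 1 a" a "0\<^sub>m a 1" C]
  by (simp add: det_single)

lemma mat_equiv_diagonal:
  fixes A :: "'a :: euclidean_ring mat"
  assumes "A \<in> carrier_mat a b"
  shows "\<exists>S. mat_equiv A S \<and> diagonal_mat S \<and> (\<forall>i. Suc i < min a b \<longrightarrow> S $$ (i, i) dvd S $$ (Suc i, Suc i))"
  using assms
proof (induction a arbitrary: b A)
  case 0
  then show ?case by (intro exI[of _ A]) (auto simp: mat_equiv_refl diagonal_mat_def)
next
  case (Suc a b' A)
  show ?case
  proof (cases "A = 0\<^sub>m (Suc a) b'")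
    case True
    then show ?thesis by (intro exI[of _ A]) (auto simp: mat_equiv_refl diagonal_mat_def)
  next
    case False
    then have "b' \<noteq> 0" using Suc.prems by (auto simp: mat_eq_iff)
    then obtain b where b': "b' = Suc b" by (cases b') auto
    obtain B where B: "mat_equiv A B" "\<forall>i<Suc a. 0 < i \<longrightarrow> B $$ (i, 0) = 0" "\<forall>j<b'. 0 < j \<longrightarrow> B $$ (0, j) = 0"
      "\<forall>i<Suc a. \<forall>j<b'. B $$ (0, 0) dvd B $$ (i, j)"
      using mat_equiv_pivot[OF Suc.prems False] by blast
    have Bc: "B \<in> carrier_mat (Suc a) (Suc b)" using mat_equiv_carrier[OF B(1) Suc.prems] b' by simp
    define p where "p = B $$ (0, 0)"
    define C where "C = mat a b (\<lambda>(i, j). B $$ (Suc i, Suc j))"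
    have Cc: "C \<in> carrier_mat a b" by (simp add: C_def)
    have B_eq: "B = bordered p C"
      using Bc B(2,3) b' by (intro eq_matI) (auto simp: C_def p_def)
    obtain S where S: "mat_equiv C S" "diagonal_mat S"
      "\<forall>i. Suc i < min a b \<longrightarrow> S $$ (i, i) dvd S $$ (Suc i, Suc i)"
      using Suc.IH[OF Cc] by blast
    have Sc: "S \<in> carrier_mat a b" using mat_equiv_carrier[OF S(1) Cc] .
    obtain U V where UV: "U \<in> carrier_mat a a" "V \<in> carrier_mat b b" "det U dvd 1" "det V dvd 1"
      "S = U * C * V" using mat_equivE[OF S(1) Cc] by blast
    have "mat_equiv B (bordered p S)"
    proof (rule mat_equivI[OF Bc, of "bordered 1 U" "bordered 1 V"])
      show "bordered p S = bordered 1 U * B * bordered 1 V"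
        unfolding B_eq bordered_mult[OF UV(1) Cc] bordered_mult[OF mult_carrier_mat[OF UV(1) Cc] UV(2)]
        by (simp only: UV(5) mult_1_left mult_1_right)
      show "det (bordered 1 U) dvd 1" "det (bordered 1 V) dvd 1"
        unfolding det_bordered[OF UV(1)] det_bordered[OF UV(2)] using UV by simp_all
    qed (use UV in auto)
    then have equiv: "mat_equiv A (bordered p S)" using B(1) mat_equiv_trans by blast
    have "\<forall>i<a. \<forall>j<b. p dvd C $$ (i, j)" using B(4) b' by (auto simp: C_def p_def)
    then have p_dvd: "\<forall>i<a. \<forall>j<b. p dvd S $$ (i, j)"
      unfolding UV(5) using UV Cc
      by (intro dvd_mat_mult_right[of _ a b] dvd_mat_mult_left[of _ a b]) auto
    show ?thesis
    proof (intro exI conjI)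
      show "mat_equiv A (bordered p S)" by fact
      show "diagonal_mat (bordered p S)"
        using S(2) Sc unfolding diagonal_mat_def by auto
      show "\<forall>i. Suc i < min (Suc a) b' \<longrightarrow> bordered p S $$ (i, i) dvd bordered p S $$ (Suc i, Suc i)"
      proof (intro allI impI)
        fix i assume "Suc i < min (Suc a) b'"
        then show "bordered p S $$ (i, i) dvd bordered p S $$ (Suc i, Suc i)"
          using Sc b' p_dvd S(3) by (cases i) auto
      qed
    qed
  qed
qed

lemma smith_form_exists: "\<exists>S. smith_form A S"
proof -
  define a b where "a = dim_row A" and "b = dim_col A"
  have A: "A \<in> carrier_mat a b" by (simp add: a_def b_def)
  obtain T where T: "mat_equiv A T" "diagonal_mat T"
    "\<forall>i. Suc i < min a b \<longrightarrow> T $$ (i, i) dvd T $$ (Suc i, Suc i)"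
    using mat_equiv_diagonal[OF A] by blast
  have Tc: "T \<in> carrier_mat a b" using mat_equiv_carrier[OF T(1) A] .
  define c where "c = (\<lambda>i. if i < a \<and> T $$ (i, i) \<noteq> 0 then [:inverse (lead_coeff (T $$ (i, i))):] else 1)"
  have c_unit: "c i dvd 1" for i by (auto simp: c_def is_unit_const_poly_iff dvd_field_iff)
  define D where "D = mat b b (\<lambda>(i, j). if i = j then c j else 0)"
  have D: "D \<in> carrier_mat b b" by (simp add: D_def)
  have "det D = (\<Prod>i = 0..<b. c i)"
    by (subst det_upper_triangular[OF _ D]) (auto simp: D_def prod_list_diag_prod)
  then have "det D dvd 1"
    using prod_dvd_prod[of "{0..<b}" c "\<lambda>_. 1"] c_unit by simp
  then have equiv: "mat_equiv A (T * D)"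
    using mat_equiv_trans[OF T(1) mat_equiv_mult_right[OF Tc D]] by blast
  have entry: "(T * D) $$ (i, j) = T $$ (i, j) * c j" if "i < a" "j < b" for i j
  proof -
    have "(T * D) $$ (i, j) = (\<Sum>k = 0..<b. T $$ (i, k) * D $$ (k, j))"
      using that Tc D by (auto simp: scalar_prod_def)
    also have "\<dots> = (\<Sum>k = 0..<b. if k = j then T $$ (i, j) * c j else 0)"
      using that by (intro sum.cong) (auto simp: D_def)
    finally show ?thesis using that by simp
  qed
  obtain U V where UV: "U \<in> carrier_mat a a" "V \<in> carrier_mat b b" "det U dvd 1" "det V dvd 1"
    "T * D = U * A * V" using mat_equivE[OF equiv A] by blast
  have TD: "T * D \<in> carrier_mat a b" using Tc D by auto
  have "smith_form A (T * D)"
    unfolding smith_form_def a_def[symmetric] b_def[symmetric]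
  proof (intro conjI)
    show "\<exists>U V. U \<in> carrier_mat a a \<and> V \<in> carrier_mat b b \<and> invertible_mat U \<and> invertible_mat V \<and> T * D = U * A * V"
      using UV invertible_mat_iff_det_dvd_1 by blast
    show "diagonal_mat (T * D)"
      unfolding diagonal_mat_def using TD T(2) Tc by (auto simp: entry diagonal_mat_def simp del: index_mult_mat(1))
    show "\<forall>i<min (dim_row (T * D)) (dim_col (T * D)). (T * D) $$ (i, i) \<noteq> 0 \<longrightarrow> lead_coeff ((T * D) $$ (i, i)) = 1"
    proof (intro allI impI)
      fix i assume i: "i < min (dim_row (T * D)) (dim_col (T * D))" and "(T * D) $$ (i, i) \<noteq> 0"
      moreover have ab: "i < a" "i < b" using i TD by auto
      ultimately have "T $$ (i, i) \<noteq> 0" by (auto simp: entry simp del: index_mult_mat(1))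
      then show "lead_coeff ((T * D) $$ (i, i)) = 1"
        unfolding entry[OF ab] c_def using ab by (simp add: lead_coeff_mult)
    qed
    show "\<forall>i. Suc i < min (dim_row (T * D)) (dim_col (T * D)) \<longrightarrow> (T * D) $$ (i, i) dvd (T * D) $$ (Suc i, Suc i)"
    proof (intro allI impI)
      fix i assume i: "Suc i < min (dim_row (T * D)) (dim_col (T * D))"
      then have "Suc i < a" "Suc i < b" using TD by auto
      moreover from this have "T $$ (i, i) dvd T $$ (Suc i, Suc i)" using T(3) by auto
      ultimately show "(T * D) $$ (i, i) dvd (T * D) $$ (Suc i, Suc i)"
        using c_unit[of i] by (simp add: entry dvd_mult2 mult_unit_dvd_iff del: index_mult_mat(1))
    qed
  qed (rule TD)
  then show ?thesis by blast
qed

lemma det_mult_zero_cols: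
  fixes A :: "'a :: comm_ring_1 mat"
  assumes A: "A \<in> carrier_mat k m" and B: "B \<in> carrier_mat m k" and "l < k"
    and zero: "\<And>i j. i < k \<Longrightarrow> l \<le> j \<Longrightarrow> j < m \<Longrightarrow> A $$ (i, j) = 0"
  shows "det (A * B) = 0"
proof -
  define A' where "A' = mat k k (\<lambda>(i, j). if j < min l m then A $$ (i, j) else 0)"
  define B' where "B' = mat k k (\<lambda>(i, j). if i < min l m then B $$ (i, j) else 0)"
  have A': "A' \<in> carrier_mat k k" and B': "B' \<in> carrier_mat k k" by (simp_all add: A'_def B'_def)
  have "A * B = A' * B'"
  proof (rule eq_matI)
    fix i j assume "i < dim_row (A' * B')" "j < dim_col (A' * B')"
    then have ij: "i < k" "j < k" using A' B' by auto
    have "(A * B) $$ (i, j) = (\<Sum>h = 0..<m. A $$ (i, h) * B $$ (h, j))"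
      using ij A B by (auto simp: scalar_prod_def)
    also have "\<dots> = (\<Sum>h = 0..<min l m. A $$ (i, h) * B $$ (h, j))"
      using zero ij by (intro sum.mono_neutral_right) auto
    also have "\<dots> = (\<Sum>h = 0..<k. A' $$ (i, h) * B' $$ (h, j))"
      using ij \<open>l < k\<close> by (intro sum.mono_neutral_cong_left) (auto simp: A'_def B'_def)
    also have "\<dots> = (A' * B') $$ (i, j)"
      using ij A' B' by (auto simp: scalar_prod_def)
    finally show "(A * B) $$ (i, j) = (A' * B') $$ (i, j)" .
  qed (use A B A' B' in auto)
  moreover have "det A' = 0"
    unfolding det_col[OF A']
  proof (rule sum.neutral, rule ballI)
    fix p assume "p \<in> {p. p permutes {0..<k}}"
    then have "p l < k" using \<open>l < k\<close> permutes_in_image[of p "{0..<k}" l] by auto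
    then have "(\<Prod>j<k. A' $$ (p j, j)) = 0"
      using \<open>l < k\<close> by (intro prod_zero) (auto simp: A'_def intro!: bexI[of _ l])
    then show "signof p * (\<Prod>j<k. A' $$ (p j, j)) = 0" by simp
  qed
  ultimately show ?thesis using det_mult[OF A' B'] by simp
qed

lemma det_top_left_block:
  fixes X :: "'a :: comm_ring_1 mat"
  assumes X: "X \<in> carrier_mat m k" and E: "E \<in> carrier_mat k k" and Y: "Y \<in> carrier_mat k m"
    and "k \<le> m" and diag: "diagonal_mat (X * E * Y)"
  obtains x y where "(\<Prod>i<k. (X * E * Y) $$ (i, i)) = x * det E * y"
proof -
  define S where "S = X * E * Y"
  define X' where "X' = mat k k (\<lambda>(i, j). X $$ (i, j))"
  define Y' where "Y' = mat k k (\<lambda>(i, j). Y $$ (i, j))"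
  define S' where "S' = mat k k (\<lambda>(i, j). S $$ (i, j))"
  have c: "X' \<in> carrier_mat k k" "Y' \<in> carrier_mat k k" "S' \<in> carrier_mat k k"
    by (simp_all add: X'_def Y'_def S'_def)
  have "S' = X' * E * Y'"
  proof (rule eq_matI)
    fix i j assume "i < dim_row (X' * E * Y')" "j < dim_col (X' * E * Y')"
    then have ij: "i < k" "j < k" using c by auto
    have row: "(X * E) $$ (i, h) = (X' * E) $$ (i, h)" if "h < k" for h
      using ij X E c \<open>k \<le> m\<close> that by (auto simp: scalar_prod_def X'_def intro!: sum.cong)
    have "S' $$ (i, j) = (\<Sum>h = 0..<k. (X * E) $$ (i, h) * Y $$ (h, j))"
      unfolding S'_def S_def using ij X E Y \<open>k \<le> m\<close> by (auto simp: scalar_prod_def simp del: assoc_mult_mat)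
    also have "\<dots> = (\<Sum>h = 0..<k. (X' * E) $$ (i, h) * Y' $$ (h, j))"
      using ij by (intro sum.cong) (auto simp: row Y'_def simp del: index_mult_mat(1))
    also have "\<dots> = (X' * E * Y') $$ (i, j)"
      using ij c E by (auto simp: scalar_prod_def simp del: assoc_mult_mat)
    finally show "S' $$ (i, j) = (X' * E * Y') $$ (i, j)" .
  qed (use c in auto)
  then have "det S' = det X' * det E * det Y'"
    using c E by (simp add: det_mult[of _ k])
  moreover have "S \<in> carrier_mat m m" using X Y by (auto simp: S_def)
  then have "det S' = (\<Prod>i<k. S $$ (i, i))"
    using diag \<open>k \<le> m\<close> unfolding S_def[symmetric]
    by (subst det_upper_triangular[OF _ c(3)])
      (auto simp: S'_def prod_list_diag_prod diagonal_mat_def atLeast0LessThan)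
  ultimately show ?thesis using that by (simp add: S_def)
qed

text \<open>The hypothesis \<open>det (X S Y) \<noteq> 0\<close> stands for \<open>rank S \<ge> k\<close>.\<close>

lemma smith_diag_nonzero:
  fixes S :: "'a :: idom mat"
  assumes X: "X \<in> carrier_mat k a" and S: "S \<in> carrier_mat a b" and Y: "Y \<in> carrier_mat b k"
    and diag: "diagonal_mat S"
    and chain: "\<And>i. Suc i < min a b \<Longrightarrow> S $$ (i, i) = 0 \<Longrightarrow> S $$ (Suc i, Suc i) = 0"
    and det: "det (X * S * Y) \<noteq> 0" and i: "i < k"
  shows "i < a" "i < b" "S $$ (i, i) \<noteq> 0"
proof -
  have "i < a \<and> i < b \<and> S $$ (i, i) \<noteq> 0"
  proof (rule ccontr)
    assume i0: "\<not> ?thesis"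
    have zero: "S $$ (h, j) = 0" if j: "i \<le> j" "j < b" and h: "h < a" for j h
    proof (cases "h = j")
      case False then show ?thesis using diag S j h by (auto simp: diagonal_mat_def)
    next
      case True
      have "S $$ (j, j) = 0"
        using j(1) j(2) h unfolding True
      proof (induction j rule: dec_induct)
        case base then show ?case using i0 by auto
      next
        case (step n) then show ?case using chain[of n] by auto
      qed
      then show ?thesis using True by simp
    qed
    have "det (X * S * Y) = 0"
      using X S Y i zero
      by (intro det_mult_zero_cols[of _ k b _ i]) (auto simp: scalar_prod_def intro!: sum.neutral)
    then show False using det by simp
  qed
  then show "i < a" "i < b" "S $$ (i, i) \<noteq> 0" by auto
qed

section \<open>Minimal bases\<close>

definition inj_mat :: "'a :: semiring_0 mat \<Rightarrow> bool" where
  "inj_mat A \<longleftrightarrow> (\<forall>v \<in> carrier_vec (dim_col A). A *\<^sub>v v = 0\<^sub>v (dim_row A) \<longrightarrow> v = 0\<^sub>v (dim_col A))"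

definition image_mat :: "'a :: semiring_0 mat \<Rightarrow> 'a vec set" where
  "image_mat A = (\<lambda>v. A *\<^sub>v v) ` carrier_vec (dim_col A)"

lemma mult_mat_unit_vec:
  assumes "(A :: 'a :: comm_ring_1 mat) \<in> carrier_mat n nc" "i < nc"
  shows "A *\<^sub>v unit_vec nc i = col A i"
  using assms by (intro eq_vecI) auto

lemma inj_mat_distinct_cols:
  fixes A :: "'a :: comm_ring_1 mat"
  assumes "inj_mat A"
  shows "distinct (cols A)"
proof -
  let ?n = "dim_row A" and ?k = "dim_col A"
  have A: "A \<in> carrier_mat ?n ?k" by simp
  have "i = j" if ij: "i < ?k" "j < ?k" "col A i = col A j" for i j
  proof (rule ccontr)
    assume "i \<noteq> j"
    define v :: "'a vec" where "v = unit_vec ?k i - unit_vec ?k j"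
    have "A *\<^sub>v v = col A i - col A j"
      using ij unfolding v_def
      by (subst mult_minus_distrib_mat_vec[OF A]) (auto simp: mult_mat_unit_vec[OF A])
    then have "v = 0\<^sub>v ?k" using assms ij by (auto simp: inj_mat_def v_def)
    then have "v $ i = 0" using ij by simp
    then show False using ij \<open>i \<noteq> j\<close> by (simp add: v_def)
  qed
  then show ?thesis by (simp add: distinct_conv_nth) blast
qed

lemma (in vec_space) basis_of_cols_iff:
  assumes A: "A \<in> carrier_mat n nc"
  shows "distinct (cols A) \<and> basis_of W (set (cols A)) \<longleftrightarrow> inj_mat A \<and> W = image_mat A"
proof -
  have span: "span (set (cols A)) = image_mat A"
    using col_space_eq[OF A] A unfolding col_space_def image_mat_def by auto
  have car: "set (cols A) \<subseteq> carrier_vec n" using cols_dim A by blast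
  have "distinct (cols A) \<and> lin_indpt (set (cols A)) \<longleftrightarrow> inj_mat A"
  proof
    assume "distinct (cols A) \<and> lin_indpt (set (cols A))"
    then show "inj_mat A" using lin_depI[OF A] A unfolding inj_mat_def by auto
  next
    assume inj: "inj_mat A"
    then have "distinct (cols A)" by (rule inj_mat_distinct_cols)
    moreover from this have "lin_indpt (set (cols A))"
      using lin_depE[OF A] inj A unfolding inj_mat_def by auto
    ultimately show "distinct (cols A) \<and> lin_indpt (set (cols A))" by simp
  qed
  then show ?thesis using span car unfolding basis_of_def by auto
qed

lemma cols_map_mat: "cols (map_mat f A) = map (map_vec f) (cols A)"
  by (rule nth_equalityI) auto

lemma polynomial_basis_cols_iff:
  assumes L: "L \<in> carrier_mat m n"
  shows "polynomial_basis m V (cols L) \<longleftrightarrow> inj_mat (fract_mat L) \<and> V = image_mat (fract_mat L)"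
proof -
  have "fract_vec ` set (cols L) = set (cols (fract_mat L))"
    by (simp add: cols_map_mat)
  moreover have "distinct (cols L) \<longleftrightarrow> distinct (cols (fract_mat L))"
    unfolding cols_map_mat distinct_map
    by (auto intro!: inj_onI dest: to_fract_hom.vec_hom_inj)
  ultimately show ?thesis
    unfolding polynomial_basis_def
    using vec_space.basis_of_cols_iff[of "fract_mat L" m n V] L by simp
qed

lemma coeff_vec_degree_less:
  assumes "vec_degree v < k" shows "vec_coeff v k = 0\<^sub>v (dim_vec v)"
proof (rule ccontr)
  assume "vec_coeff v k \<noteq> 0\<^sub>v (dim_vec v)"
  then have "k \<le> vec_degree v"
    unfolding vec_degree_def using finite_vec_coeff_nonzero by (intro Max_ge) auto
  then show False using assms by simp
qed

lemma vec_coeff_vec_degree: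
  assumes "v \<noteq> 0\<^sub>v (dim_vec v)"
  shows "vec_coeff v (vec_degree v) \<noteq> 0\<^sub>v (dim_vec v)"
proof -
  let ?S = "{k. vec_coeff v k \<noteq> 0\<^sub>v (dim_vec v)}"
  obtain i where i: "i < dim_vec v" "v $ i \<noteq> 0" using assms by (auto simp: vec_eq_iff)
  have "degree (v $ i) \<in> ?S"
    using i by (auto simp: vec_coeff_def vec_eq_iff intro!: exI[of _ i])
  moreover have "vec_degree v = Max ?S"
    unfolding vec_degree_def using finite_vec_coeff_nonzero calculation
    by (subst Max_insert) (auto simp: max_def)
  ultimately show ?thesis using Max_in[OF finite_vec_coeff_nonzero[of v]] by auto
qed

lemma degree_le_vec_degree:
  assumes "i < dim_vec v" shows "degree (v $ i) \<le> vec_degree v"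
proof (rule degree_le, intro allI impI)
  fix k assume "vec_degree v < k"
  from coeff_vec_degree_less[OF this] assms show "coeff (v $ i) k = 0"
    by (auto simp: vec_coeff_def vec_eq_iff)
qed

text \<open>Column \<open>i\<close> of \<open>L\<close> may be exchanged for \<open>w\<close>.  The conclusion is \<open>vec_degree (col L i) \<le> vec_degree w\<close>
  together with \<open>w \<noteq> 0\<close>, which the convention \<open>vec_degree 0 = 0\<close> would hide.\<close>

lemma minimal_basis_exchange:
  assumes min: "minimal_basis m V (cols L)" and L: "L \<in> carrier_mat m n"
    and x: "x \<in> carrier_vec n" and w: "w \<in> carrier_vec m" and Lx: "L *\<^sub>v x = q \<cdot>\<^sub>v w"
    and i: "i < n" "x $ i \<noteq> 0" and q: "q \<noteq> 0"
  shows "\<exists>k \<ge> vec_degree (col L i). vec_coeff w k \<noteq> 0\<^sub>v m"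
proof -
  let ?F = "fract_mat L"
  have F: "?F \<in> carrier_mat m n" using L by simp
  have inj: "inj_mat ?F" and V: "V = image_mat ?F"
    using min polynomial_basis_cols_iff[OF L] unfolding minimal_basis_def by auto
  define y where "y = inverse (to_fract q) \<cdot>\<^sub>v fract_vec x"
  have y: "y \<in> carrier_vec n" using x by (simp add: y_def)
  have yi: "y $ i \<noteq> 0" using x i q by (simp add: y_def)
  have Fy: "?F *\<^sub>v y = fract_vec w"
  proof -
    have "?F *\<^sub>v y = inverse (to_fract q) \<cdot>\<^sub>v fract_vec (L *\<^sub>v x)"
      unfolding y_def using F L x
      by (simp add: mult_mat_vec to_fract_hom.mult_mat_vec_hom[OF L x])
    also have "\<dots> = fract_vec w"
      unfolding Lx to_fract_hom.vec_hom_smult using q by (simp add: smult_smult_assoc)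
    finally show ?thesis .
  qed
  define T where "T = replace_col (1\<^sub>m n) y i"
  have T: "T \<in> carrier_mat n n" by (simp add: T_def replace_col_def)
  have "det T = y $ i"
    using cramer_lemma_mat[OF one_carrier_mat y i(1)] y by (simp add: T_def)
  then obtain T' where T': "T' \<in> carrier_mat n n" "T * T' = 1\<^sub>m n" "T' * T = 1\<^sub>m n"
    using unimodular_inverse[OF T] yi by (auto simp: dvd_field_iff)
  define L' where "L' = replace_col L w i"
  have L': "L' \<in> carrier_mat m n" using L by (simp add: L'_def replace_col_def)
  have "fract_mat L' = ?F * T"
  proof (rule eq_matI)
    fix a b assume "a < dim_row (?F * T)" "b < dim_col (?F * T)"
    then have ab: "a < m" "b < n" using F T by auto
    have "col T b = (if b = i then y else unit_vec n b)"
      using ab y by (auto simp: T_def replace_col_def)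
    then have "(?F * T) $$ (a, b) = (?F *\<^sub>v (if b = i then y else unit_vec n b)) $ a"
      using ab F T by simp
    also have "\<dots> = fract_mat L' $$ (a, b)"
      using ab L w by (simp add: Fy mult_mat_unit_vec[OF F] L'_def replace_col_def del: index_mult_mat_vec)
    finally show "fract_mat L' $$ (a, b) = (?F * T) $$ (a, b)" by simp
  qed (use L L' T in auto)
  note L'T = this
  have "inj_mat (fract_mat L')"
    unfolding inj_mat_def
  proof (intro ballI impI)
    fix v assume "v \<in> carrier_vec (dim_col (fract_mat L'))"
      and "fract_mat L' *\<^sub>v v = 0\<^sub>v (dim_row (fract_mat L'))"
    then have v: "v \<in> carrier_vec n" and "?F *\<^sub>v (T *\<^sub>v v) = 0\<^sub>v m"
      using L' F T unfolding L'T by auto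
    then have "T *\<^sub>v v = 0\<^sub>v n" using inj F T unfolding inj_mat_def by auto
    moreover have "v = T' *\<^sub>v (T *\<^sub>v v)"
      using T T' v by (metis assoc_mult_mat_vec one_mult_mat_vec)
    ultimately show "v = 0\<^sub>v (dim_col (fract_mat L'))" using T'(1) L' by auto
  qed
  moreover have "V = image_mat (fract_mat L')"
    unfolding V
  proof
    show "image_mat (fract_mat L') \<subseteq> image_mat ?F"
      unfolding image_mat_def L'T using F T by auto
    show "image_mat ?F \<subseteq> image_mat (fract_mat L')"
    proof
      fix u assume "u \<in> image_mat ?F"
      then obtain v where v: "v \<in> carrier_vec n" "u = ?F *\<^sub>v v" using F by (auto simp: image_mat_def)
      then have "u = ?F *\<^sub>v (T *\<^sub>v (T' *\<^sub>v v))"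
        using T T' by (metis assoc_mult_mat_vec one_mult_mat_vec)
      then have "u = (?F * T) *\<^sub>v (T' *\<^sub>v v)" using F T T' v by simp
      then show "u \<in> image_mat (fract_mat L')"
        unfolding image_mat_def L'T using T T'(1) v by auto
    qed
  qed
  ultimately have "polynomial_basis m V (cols L')"
    using polynomial_basis_cols_iff[OF L'] by simp
  then have le: "(\<Sum>b\<leftarrow>cols L. vec_degree b) \<le> (\<Sum>c\<leftarrow>cols L'. vec_degree c)"
    using min unfolding minimal_basis_def by blast
  have sum: "(\<Sum>b\<leftarrow>cols M. vec_degree b) = (\<Sum>j<n. vec_degree (col M j))"
    if "M \<in> carrier_mat m n" for M
    using that by (simp add: sum_list_sum_nth atLeast0LessThan)
  have "(\<Sum>j\<in>{..<n} - {i}. vec_degree (col L' j)) = (\<Sum>j\<in>{..<n} - {i}. vec_degree (col L j))"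
  proof (rule sum.cong[OF refl])
    fix j assume "j \<in> {..<n} - {i}"
    then have "col L' j = col L j" using L by (intro eq_vecI) (auto simp: L'_def replace_col_def)
    then show "vec_degree (col L' j) = vec_degree (col L j)" by simp
  qed
  moreover have "col L' i = w" using L w i by (intro eq_vecI) (auto simp: L'_def replace_col_def)
  ultimately have deg: "vec_degree (col L i) \<le> vec_degree w"
    using le i unfolding sum[OF L] sum[OF L'] by (simp add: sum.remove[of "{..<n}" i])
  have "w \<noteq> 0\<^sub>v m"
  proof
    assume "w = 0\<^sub>v m"
    then have "?F *\<^sub>v y = 0\<^sub>v m" using Fy by simp
    then have "y = 0\<^sub>v n" using inj F y unfolding inj_mat_def by auto
    then show False using yi i by simp
  qed
  then show ?thesis
    using deg vec_coeff_vec_degree[of w] w by (intro exI[of _ "vec_degree w"]) auto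
qed

lemma mult_mat_vec_sum:
  "A \<in> carrier_mat m n \<Longrightarrow> x \<in> carrier_vec n \<Longrightarrow> a < m \<Longrightarrow>
    (A *\<^sub>v x) $ a = (\<Sum>j<n. A $$ (a, j) * x $ j)"
  by (auto simp: scalar_prod_def atLeast0LessThan)

lemma coeff_mult_degree_le:
  fixes p q :: "'a :: comm_semiring_1 poly"
  assumes "degree p \<le> a" "degree q \<le> b"
  shows "coeff (p * q) (a + b) = coeff p a * coeff q b"
proof -
  have "coeff (p * q) (a + b) = (\<Sum>i\<le>a + b. coeff p i * coeff q (a + b - i))"
    by (rule coeff_mult)
  also have "\<dots> = (\<Sum>i\<in>{a}. coeff p i * coeff q (a + b - i))"
  proof (rule sum.mono_neutral_right)
    show "\<forall>i\<in>{..a + b} - {a}. coeff p i * coeff q (a + b - i) = 0"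
    proof
      fix i assume "i \<in> {..a + b} - {a}"
      then have "degree p < i \<or> degree q < a + b - i" using assms by auto
      then show "coeff p i * coeff q (a + b - i) = 0" by (auto simp: coeff_eq_0)
    qed
  qed auto
  finally show ?thesis by simp
qed

lemma degree_entry_le_vec_degree:
  assumes "L \<in> carrier_mat m n" "a < m" "j < n"
  shows "degree (L $$ (a, j)) \<le> vec_degree (col L j)"
  using degree_le_vec_degree[of a "col L j"] assms by simp

text \<open>If \<open>L(\<alpha>) c = 0\<close> for a constant \<open>c \<noteq> 0\<close>, then \<open>L c / (\<lambda> - \<alpha>)\<close> could replace the
  column of highest degree in the support of \<open>c\<close>.\<close>

lemma minimal_basis_no_root:
  assumes min: "minimal_basis m V (cols L)" and L: "L \<in> carrier_mat m n"
    and c: "c \<in> carrier_vec n" "\<forall>i<n. degree (c $ i) = 0"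
    and w: "w \<in> carrier_vec m" and Lc: "L *\<^sub>v c = [:- \<alpha>, 1:] \<cdot>\<^sub>v w"
  shows "c = 0\<^sub>v n"
proof (rule ccontr)
  assume "c \<noteq> 0\<^sub>v n"
  then obtain i0 where "i0 < n" "c $ i0 \<noteq> 0" using c by (auto simp: vec_eq_iff)
  then have ne: "{j. j < n \<and> c $ j \<noteq> 0} \<noteq> {}" by auto
  define D where "D = Max ((\<lambda>j. vec_degree (col L j)) ` {j. j < n \<and> c $ j \<noteq> 0})"
  have "D \<in> (\<lambda>j. vec_degree (col L j)) ` {j. j < n \<and> c $ j \<noteq> 0}"
    unfolding D_def using ne by (intro Max_in) auto
  then obtain i where i: "i < n" "c $ i \<noteq> 0" "D = vec_degree (col L i)" by auto
  have D: "vec_degree (col L j) \<le> D" if "j < n" "c $ j \<noteq> 0" for j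
    unfolding D_def using that by (intro Max_ge) auto
  obtain k where k: "D \<le> k" "vec_coeff w k \<noteq> 0\<^sub>v m"
    using minimal_basis_exchange[OF min L c(1) w Lc i(1,2)] i(3) by auto
  then obtain a where a: "a < m" "coeff (w $ a) k \<noteq> 0"
    using w by (auto simp: vec_coeff_def vec_eq_iff)
  have "degree ((L *\<^sub>v c) $ a) = Suc (degree (w $ a))"
  proof -
    have "(L *\<^sub>v c) $ a = [:- \<alpha>, 1:] * w $ a" using a w unfolding Lc by simp
    moreover have "w $ a \<noteq> 0" using a by auto
    ultimately show ?thesis by (simp add: degree_mult_eq del: mult_pCons_left)
  qed
  moreover have "k \<le> degree (w $ a)" using a by (intro le_degree)
  moreover have "degree ((L *\<^sub>v c) $ a) \<le> D"
    unfolding mult_mat_vec_sum[OF L c(1) a(1)]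
  proof (rule degree_sum_le)
    fix j assume "j \<in> {..<n}"
    then have j: "j < n" by simp
    show "degree (L $$ (a, j) * c $ j) \<le> D"
    proof (cases "c $ j = 0")
      case False
      then show ?thesis
        using degree_mult_le[of "L $$ (a, j)" "c $ j"] c(2) j D[OF j False]
          degree_entry_le_vec_degree[OF L a(1) j] by simp
    qed simp
  qed simp
  ultimately show False using k by simp
qed

lemma minimal_basis_left_inverse:
  assumes min: "minimal_basis m V (cols L)" and L: "L \<in> carrier_mat m n"
  obtains G where "G \<in> carrier_mat n m" "G * L = 1\<^sub>m n"
proof -
  obtain S where S: "smith_form L S" using smith_form_exists by blast
  then obtain U W where UW: "U \<in> carrier_mat m m" "W \<in> carrier_mat n n"
    "invertible_mat U" "invertible_mat W" "S = U * L * W"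
    using L unfolding smith_form_def by auto
  have Sc: "S \<in> carrier_mat m n" using UW L by auto
  obtain U' where U': "U' \<in> carrier_mat m m" "U * U' = 1\<^sub>m m" "U' * U = 1\<^sub>m m"
    using unimodular_inverse[OF UW(1)] UW invertible_mat_iff_det_dvd_1 by blast
  obtain W' where W': "W' \<in> carrier_mat n n" "W * W' = 1\<^sub>m n" "W' * W = 1\<^sub>m n"
    using unimodular_inverse[OF UW(2)] UW invertible_mat_iff_det_dvd_1 by blast
  have "U' * S = U' * U * (L * W)" using U'(1) UW L by (simp add: assoc_mult_mat[of _ m m _ m _ n])
  then have LW: "L * W = U' * S" using U' UW L by auto
  have off: "S $$ (a, i) = 0" if "a < m" "i < n" "a \<noteq> i" for a i
    using S Sc that unfolding smith_form_def diagonal_mat_def by auto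
  have diag: "i < m \<and> S $$ (i, i) = 1" if i: "i < n" for i
  proof (rule ccontr)
    assume neg: "\<not> ?thesis"
    obtain \<alpha> where \<alpha>: "i < m \<Longrightarrow> poly (S $$ (i, i)) \<alpha> = 0"
    proof (cases "i < m \<and> S $$ (i, i) \<noteq> 0")
      case True
      then have "lead_coeff (S $$ (i, i)) = 1" using S Sc i unfolding smith_form_def by auto
      then have "degree (S $$ (i, i)) \<noteq> 0" using neg True
        by (metis degree_eq_zeroE lead_coeff_pCons(2) one_pCons)
      then have "\<not> constant (poly (S $$ (i, i)))" by (simp add: constant_degree)
      then obtain z where "poly (S $$ (i, i)) z = 0" using fundamental_theorem_of_algebra by blast
      then show ?thesis using that by blast
    next
      case False
      then show ?thesis using that[of 0] by auto
    qed
    define q where "q = [:- \<alpha>, 1:]"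
    define u where "u = vec m (\<lambda>a. S $$ (a, i) div q)"
    have "q dvd S $$ (a, i)" if "a < m" for a
      using off[OF that i] \<alpha> that by (cases "a = i") (auto simp: q_def poly_eq_0_iff_dvd)
    then have Su: "col S i = q \<cdot>\<^sub>v u" using Sc i by (intro eq_vecI) (auto simp: u_def)
    define c where "c = vec n (\<lambda>j. [:poly (W $$ (j, i)) \<alpha>:])"
    define z where "z = vec n (\<lambda>j. (W $$ (j, i) - [:poly (W $$ (j, i)) \<alpha>:]) div q)"
    have "q dvd W $$ (j, i) - [:poly (W $$ (j, i)) \<alpha>:]" for j
      unfolding q_def poly_eq_0_iff_dvd[symmetric] by simp
    then have Wc: "col W i - q \<cdot>\<^sub>v z = c"
      using UW(2) i by (intro eq_vecI) (auto simp: c_def z_def)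
    have cc: "c \<in> carrier_vec n" "z \<in> carrier_vec n" "u \<in> carrier_vec m"
      by (simp_all add: c_def z_def u_def)
    have colW: "col W i \<in> carrier_vec n" using UW(2) i by auto
    have smult: "A *\<^sub>v (q \<cdot>\<^sub>v v) = q \<cdot>\<^sub>v (A *\<^sub>v v)"
      if "A \<in> carrier_mat m b" "v \<in> carrier_vec b" for A v b
      using that by (intro eq_vecI) auto
    have "L *\<^sub>v col W i = col (L * W) i" using L UW(2) i by auto
    also have "\<dots> = U' *\<^sub>v col S i" unfolding LW using U' Sc i by auto
    also have "\<dots> = q \<cdot>\<^sub>v (U' *\<^sub>v u)" unfolding Su by (rule smult[OF U'(1) cc(3)])
    finally have "L *\<^sub>v c = q \<cdot>\<^sub>v (U' *\<^sub>v u) - q \<cdot>\<^sub>v (L *\<^sub>v z)"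
      unfolding Wc[symmetric] using L colW cc
      by (subst mult_minus_distrib_mat_vec[OF L]) (auto simp: smult[OF L])
    also have "\<dots> = q \<cdot>\<^sub>v (U' *\<^sub>v u - L *\<^sub>v z)"
      using L U'(1) cc by (intro eq_vecI) (auto simp: algebra_simps)
    finally have "L *\<^sub>v c = q \<cdot>\<^sub>v (U' *\<^sub>v u - L *\<^sub>v z)" .
    then have "c = 0\<^sub>v n"
      using U'(1) L cc unfolding q_def
      by (intro minimal_basis_no_root[OF min L, of _ "U' *\<^sub>v u - L *\<^sub>v z"]) (auto simp: c_def)
    then have root: "poly (W $$ (j, i)) \<alpha> = 0" if "j < n" for j
      using that by (auto simp: c_def vec_eq_iff)
    have "1 = (W' * W) $$ (i, i)" using W' i by simp
    also have "\<dots> = (\<Sum>j<n. W' $$ (i, j) * W $$ (j, i))"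
      using i W'(1) UW(2) by (auto simp: scalar_prod_def atLeast0LessThan)
    finally have "poly 1 \<alpha> = poly (\<Sum>j<n. W' $$ (i, j) * W $$ (j, i)) \<alpha>" by simp
    then show False by (simp add: poly_sum root)
  qed
  define J where "J = mat n m (\<lambda>(i, j). if i = j then 1 else 0 :: complex poly)"
  have J: "J \<in> carrier_mat n m" by (simp add: J_def)
  have "J * S = 1\<^sub>m n"
  proof (rule eq_matI)
    fix i j assume "i < dim_row (1\<^sub>m n :: complex poly mat)" "j < dim_col (1\<^sub>m n :: complex poly mat)"
    then have ij: "i < n" "j < n" by auto
    have "(J * S) $$ (i, j) = (\<Sum>k = 0..<m. J $$ (i, k) * S $$ (k, j))"
      using ij J Sc by (auto simp: scalar_prod_def)
    also have "\<dots> = (\<Sum>k = 0..<m. if k = i then S $$ (i, j) else 0)"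
      using ij by (intro sum.cong) (auto simp: J_def)
    also have "\<dots> = 1\<^sub>m n $$ (i, j)" using diag ij off by auto
    finally show "(J * S) $$ (i, j) = 1\<^sub>m n $$ (i, j)" .
  qed (use J Sc in auto)
  moreover have "L = U' * S * W'"
  proof -
    have "U' * S * W' = L * (W * W')" unfolding LW[symmetric]
      using L UW(2) W'(1) by (simp add: assoc_mult_mat[of _ m n _ n _ n])
    then show ?thesis using L W' by simp
  qed
  moreover have "W * J * U * (U' * S * W') = W * (J * ((U * U') * S)) * W'"
    using UW(1,2) U'(1) W'(1) J Sc
    by (simp add: assoc_mult_mat[of _ n n _ m _ m] assoc_mult_mat[of _ n n _ m _ n]
      assoc_mult_mat[of _ n m _ m _ n] assoc_mult_mat[of _ m m _ m _ n] assoc_mult_mat[of _ n m _ m _ m]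
      assoc_mult_mat[of _ m n _ n _ n] assoc_mult_mat[of _ m m _ n _ n] assoc_mult_mat[of _ n n _ n _ n]
      assoc_mult_mat[of _ n m _ n _ n])
  ultimately have "W * J * U * L = 1\<^sub>m n"
    using U' W' Sc UW(2) by simp
  then show ?thesis using that[of "W * J * U"] UW J by auto
qed

lemma minimal_basis_leading_coeffs:
  assumes min: "minimal_basis m V (cols L)" and L: "L \<in> carrier_mat m n"
    and zero: "\<And>a. a < m \<Longrightarrow> (\<Sum>j<n. coeff (L $$ (a, j)) (vec_degree (col L j)) * c j) = 0"
    and "i < n"
  shows "c i = 0"
proof (rule ccontr)
  let ?d = "\<lambda>j. vec_degree (col L j)"
  assume "c i \<noteq> 0"
  then have ne: "{j. j < n \<and> c j \<noteq> 0} \<noteq> {}" using \<open>i < n\<close> by auto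
  define D where "D = Max (?d ` {j. j < n \<and> c j \<noteq> 0})"
  have "D \<in> ?d ` {j. j < n \<and> c j \<noteq> 0}"
    unfolding D_def using ne by (intro Max_in) auto
  then obtain h where h: "h < n" "c h \<noteq> 0" "D = ?d h" by auto
  have D: "?d j \<le> D" if "j < n" "c j \<noteq> 0" for j
    unfolding D_def using that by (intro Max_ge) auto
  define x where "x = vec n (\<lambda>j. monom (c j) (D - ?d j))"
  have x: "x \<in> carrier_vec n" by (simp add: x_def)
  have "L *\<^sub>v x \<in> carrier_vec m" using L x by auto
  moreover have "L *\<^sub>v x = 1 \<cdot>\<^sub>v (L *\<^sub>v x)" by simp
  ultimately obtain k where k: "D \<le> k" "vec_coeff (L *\<^sub>v x) k \<noteq> 0\<^sub>v m"
    using minimal_basis_exchange[OF min L x, of "L *\<^sub>v x" 1 h] h by (auto simp: x_def)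
  then obtain a where a: "a < m" "coeff ((L *\<^sub>v x) $ a) k \<noteq> 0"
    using L by (auto simp: vec_coeff_def vec_eq_iff)
  have "coeff ((L *\<^sub>v x) $ a) k = (\<Sum>j<n. coeff (L $$ (a, j) * monom (c j) (D - ?d j)) k)"
    unfolding mult_mat_vec_sum[OF L x a(1)] by (simp add: coeff_sum x_def)
  also have "\<dots> = (\<Sum>j<n. if k = D then coeff (L $$ (a, j)) (?d j) * c j else 0)"
  proof (rule sum.cong[OF refl])
    fix j assume "j \<in> {..<n}"
    then have j: "j < n" by simp
    show "coeff (L $$ (a, j) * monom (c j) (D - ?d j)) k
      = (if k = D then coeff (L $$ (a, j)) (?d j) * c j else 0)"
    proof (cases "c j = 0")
      case False
      have "coeff (L $$ (a, j) * monom (c j) (D - ?d j)) k = coeff (L $$ (a, j)) (k - (D - ?d j)) * c j"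
        using k(1) by (auto simp: coeff_monom_mult mult.commute[of "L $$ (a, j)"])
      moreover have "coeff (L $$ (a, j)) (k - (D - ?d j)) = 0" if "k \<noteq> D"
        using that k(1) D[OF j False] degree_entry_le_vec_degree[OF L a(1) j]
        by (intro coeff_eq_0) linarith
      moreover have "D - (D - ?d j) = ?d j" using D[OF j False] by simp
      ultimately show ?thesis by auto
    qed simp
  qed
  also have "\<dots> = 0" using zero[OF a(1)] by (cases "k = D") auto
  finally show False using a by simp
qed

text \<open>The summand \<open>e\<close> makes the bound meaningful even when
  \<open>D - e\<close> would be negative.\<close>

lemma minimal_basis_predictable_degree:
  assumes min: "minimal_basis m V (cols L)" and L: "L \<in> carrier_mat m n"
    and x: "x \<in> carrier_vec n"
    and bound: "\<And>a. a < m \<Longrightarrow> (L *\<^sub>v x) $ a \<noteq> 0 \<Longrightarrow> e + degree ((L *\<^sub>v x) $ a) \<le> D"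
    and i: "i < n" "x $ i \<noteq> 0"
  shows "e + vec_degree (col L i) + degree (x $ i) \<le> D"
proof -
  let ?d = "\<lambda>j. vec_degree (col L j)"
  let ?N = "{j. j < n \<and> x $ j \<noteq> 0}"
  define M where "M = Max ((\<lambda>j. ?d j + degree (x $ j)) ` ?N)"
  have "M \<in> (\<lambda>j. ?d j + degree (x $ j)) ` ?N"
    unfolding M_def using i by (intro Max_in) auto
  then obtain h where h: "h < n" "x $ h \<noteq> 0" "M = ?d h + degree (x $ h)" by auto
  have M: "?d j + degree (x $ j) \<le> M" if "j < n" "x $ j \<noteq> 0" for j
    unfolding M_def using that by (intro Max_ge) auto
  define c where "c = (\<lambda>j. coeff (x $ j) (M - ?d j))"
  have "c h \<noteq> 0" using h by (simp add: c_def)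
  then obtain a where a: "a < m" "(\<Sum>j<n. coeff (L $$ (a, j)) (?d j) * c j) \<noteq> 0"
    using minimal_basis_leading_coeffs[OF min L _ h(1)] by blast
  have "coeff ((L *\<^sub>v x) $ a) M = (\<Sum>j<n. coeff (L $$ (a, j) * x $ j) M)"
    unfolding mult_mat_vec_sum[OF L x a(1)] by (simp add: coeff_sum)
  also have "\<dots> = (\<Sum>j<n. coeff (L $$ (a, j)) (?d j) * c j)"
  proof (rule sum.cong[OF refl])
    fix j assume "j \<in> {..<n}"
    then have j: "j < n" by simp
    show "coeff (L $$ (a, j) * x $ j) M = coeff (L $$ (a, j)) (?d j) * c j"
    proof (cases "x $ j = 0")
      case True then show ?thesis by (simp add: c_def)
    next
      case False
      then have "M = ?d j + (M - ?d j)" "degree (x $ j) \<le> M - ?d j" using M[OF j] by auto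
      then show ?thesis
        using coeff_mult_degree_le[OF degree_entry_le_vec_degree[OF L a(1) j], of "x $ j" "M - ?d j"]
        by (simp add: c_def)
    qed
  qed
  finally have "coeff ((L *\<^sub>v x) $ a) M \<noteq> 0" using a by simp
  then have "(L *\<^sub>v x) $ a \<noteq> 0" "M \<le> degree ((L *\<^sub>v x) $ a)" by (auto intro: le_degree)
  then show ?thesis using bound[OF a(1)] M[OF i] by linarith
qed

section \<open>The skew-symmetric factorization\<close>

lemma (in vec_space) maximal_indpt_span:
  assumes S: "S \<subseteq> carrier_vec n"
    and max: "maximal B (\<lambda>T. T \<subseteq> S \<and> lin_indpt T)"
  shows "span B = span S"
proof
  have B: "B \<subseteq> S" "lin_indpt B" using max by (auto simp: maximal_def)
  then have Bc: "B \<subseteq> carrier_vec n" using S by blast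
  show "span B \<subseteq> span S" using B span_is_monotone by blast
  have "S \<subseteq> span B"
  proof
    fix s assume s: "s \<in> S"
    show "s \<in> span B"
    proof (cases "s \<in> B")
      case True then show ?thesis using span_mem[OF Bc] by blast
    next
      case False
      then have "lin_dep (B \<union> {s})" using max s B unfolding maximal_def by blast
      then show ?thesis using lin_dep_iff_in_span[of B s] B Bc S s False by auto
    qed
  qed
  then show "span S \<subseteq> span B" using span_is_subset span_is_submodule Bc by simp
qed

lemma (in vec_space) col_space_eq_image_mat:
  assumes "A \<in> carrier_mat n nc" shows "col_space A = image_mat A"
  using col_space_eq[OF assms] assms unfolding image_mat_def by auto

lemma Col_eq_image_mat: "Col P = image_mat (fract_mat P)"
  unfolding Col_def by (rule vec_space.col_space_eq_image_mat[of _ _ "dim_col P"]) simp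

lemma polynomial_basis_exists: "\<exists>bs. polynomial_basis (dim_row P) (Col P) bs"
proof -
  let ?F = "fract_mat P" and ?n = "dim_row P"
  interpret vec_space "TYPE(complex poly fract)" ?n .
  obtain S where S: "maximal S (\<lambda>T. T \<subseteq> set (cols ?F) \<and> lin_indpt T)"
    using maximal_exists[of "\<lambda>T. T \<subseteq> set (cols ?F) \<and> lin_indpt T" "card (set (cols ?F))" "{}"]
    by (meson List.finite_set card_mono empty_iff empty_subsetI finite_lin_indpt2 rev_finite_subset)
  have car: "set (cols ?F) \<subseteq> carrier_vec ?n" using cols_dim[of ?F] by simp
  have Ss: "S \<subseteq> fract_vec ` set (cols P)" "lin_indpt S"
    using S by (auto simp: maximal_def cols_map_mat)
  then obtain S' where S': "S' \<subseteq> set (cols P)" "S = fract_vec ` S'" by (meson subset_imageE)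
  have "finite S'" using S' finite_subset by auto
  then obtain bs where bs: "distinct bs" "set bs = S'" using finite_distinct_list by blast
  have "S \<subseteq> carrier_vec ?n" using S car by (auto simp: maximal_def)
  then have "polynomial_basis ?n (Col P) bs"
    unfolding polynomial_basis_def basis_of_def Col_def col_space_def
    using bs S' Ss maximal_indpt_span[OF car S] by simp
  then show ?thesis by blast
qed

lemma polynomial_basis_length:
  assumes bs: "polynomial_basis (dim_row P) (Col P) bs"
  shows "length bs = normal_rank P" "set bs \<subseteq> carrier_vec (dim_row P)"
proof -
  let ?n = "dim_row P"
  interpret vec_space "TYPE(complex poly fract)" ?n .
  have b: "distinct bs" "fract_vec ` set bs \<subseteq> carrier_vec ?n" "lin_indpt (fract_vec ` set bs)"
    "span (fract_vec ` set bs) = span (set (cols (fract_mat P)))"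
    using bs unfolding polynomial_basis_def basis_of_def Col_def col_space_def by auto
  show car: "set bs \<subseteq> carrier_vec ?n" using b(2) by auto
  define L where "L = mat_of_cols ?n bs"
  have L: "L \<in> carrier_mat ?n (length bs)" "cols L = bs" using car by (auto simp: L_def)
  have set: "set (cols (fract_mat L)) = fract_vec ` set bs" by (simp add: cols_map_mat L)
  have "distinct (cols (fract_mat L))"
    unfolding cols_map_mat distinct_map L(2)
    using b(1) by (auto intro!: inj_onI dest: to_fract_hom.vec_hom_inj)
  then have "rank (fract_mat L) = length bs"
    using b(3) L(1) set by (intro lin_indpt_full_rank) auto
  then show "length bs = normal_rank P"
    unfolding normal_rank_def rank_def set b(4) by simp
qed

lemma minimal_basis_exists:
  assumes "dim_row P = m" "normal_rank P = n"
  obtains L where "L \<in> carrier_mat m n" "minimal_basis m (Col P) (cols L)"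
proof -
  obtain bs0 where "polynomial_basis m (Col P) bs0"
    using polynomial_basis_exists[of P] assms by auto
  from ex_has_least_nat[of "polynomial_basis m (Col P)", OF this, of "\<lambda>bs. \<Sum>b\<leftarrow>bs. vec_degree b"]
  obtain bs where min: "minimal_basis m (Col P) bs" unfolding minimal_basis_def by blast
  then have bs: "length bs = n" "set bs \<subseteq> carrier_vec m"
    using polynomial_basis_length[of P bs] assms unfolding minimal_basis_def by auto
  show ?thesis
    using min bs by (intro that[of "mat_of_cols m bs"]) auto
qed

lemma skew_symmetric_matpoly_iff:
  "skew_symmetric_matpoly A \<longleftrightarrow> square_mat A \<and> A\<^sup>T = - A"
proof -
  have "(\<forall>k. (mat_coeff A k)\<^sup>T = - mat_coeff A k) \<longleftrightarrow> A\<^sup>T = - A" if sq: "dim_row A = dim_col A"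
  proof -
    let ?n = "dim_col A"
    have "(\<forall>k. (mat_coeff A k)\<^sup>T = - mat_coeff A k)
      \<longleftrightarrow> (\<forall>k. \<forall>i<?n. \<forall>j<?n. coeff (A $$ (j, i)) k = - coeff (A $$ (i, j)) k)"
      by (simp add: mat_coeff_def mat_eq_iff sq)
    also have "\<dots> \<longleftrightarrow> (\<forall>i<?n. \<forall>j<?n. A $$ (j, i) = - A $$ (i, j))"
      unfolding poly_eq_iff by simp blast
    also have "\<dots> \<longleftrightarrow> A\<^sup>T = - A" by (simp add: mat_eq_iff sq)
    finally show ?thesis .
  qed
  then show ?thesis unfolding skew_symmetric_matpoly_def by auto
qed

lemma image_mat_subset_factor:
  fixes A B :: "'a :: comm_ring_1 mat"
  assumes A: "A \<in> carrier_mat m n" and B: "B \<in> carrier_mat m k" and sub: "image_mat A \<subseteq> image_mat B"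
  obtains Y where "Y \<in> carrier_mat k n" "A = B * Y"
proof -
  have "\<exists>v \<in> carrier_vec k. B *\<^sub>v v = col A j" if "j < n" for j
  proof -
    have "col A j \<in> image_mat A"
      unfolding image_mat_def using A that mult_mat_unit_vec[OF A that]
      by (intro image_eqI[of _ _ "unit_vec n j"]) auto
    then have "col A j \<in> image_mat B" using sub by blast
    then obtain v where "v \<in> carrier_vec k" "col A j = B *\<^sub>v v"
      unfolding image_mat_def using B by blast
    then show ?thesis by metis
  qed
  then obtain f where f: "\<And>j. j < n \<Longrightarrow> f j \<in> carrier_vec k" "\<And>j. j < n \<Longrightarrow> B *\<^sub>v f j = col A j"
    by metis
  define Y where "Y = mat_of_cols k (map f [0..<n])"
  have Y: "Y \<in> carrier_mat k n"
    unfolding Y_def using mat_of_cols_carrier(1)[of k "map f [0..<n]"] by simp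
  have "A = B * Y"
  proof (rule eq_matI)
    fix i j assume "i < dim_row (B * Y)" "j < dim_col (B * Y)"
    then have ij: "i < m" "j < n" using B Y by auto
    have "col Y j = f j" using ij f(1) by (simp add: Y_def)
    then have "(B * Y) $$ (i, j) = (B *\<^sub>v f j) $ i" using ij B Y by simp
    then show "A $$ (i, j) = (B * Y) $$ (i, j)" using f(2)[OF ij(2)] ij A by simp
  qed (use A B Y in auto)
  then show ?thesis using that Y by blast
qed

lemma skew_congruence:
  assumes P: "(P :: 'a :: comm_ring_1 mat) \<in> carrier_mat m m" "P\<^sup>T = - P" and G: "G \<in> carrier_mat n m"
  shows "(G * P * G\<^sup>T)\<^sup>T = - (G * P * G\<^sup>T)"
proof -
  have "(G * P * G\<^sup>T)\<^sup>T = G * (P\<^sup>T * G\<^sup>T)"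
    using P G by (subst transpose_mult[of _ n m _ n]) (auto simp: transpose_mult[of _ n m _ m])
  also have "\<dots> = - (G * P * G\<^sup>T)"
    unfolding P(2) using P G by (simp add: assoc_mult_mat[of _ n m _ m _ n])
  finally show ?thesis .
qed

lemma skew_factorization_exists:
  assumes P: "P \<in> carrier_mat m m" "skew_symmetric_matpoly P" "normal_rank P = 2 * r"
  shows "\<exists>L E. skew_factorization m r P L E"
proof -
  define n where "n = 2 * r"
  obtain L where L: "L \<in> carrier_mat m n" and min: "minimal_basis m (Col P) (cols L)"
    using minimal_basis_exists[of P m n] P n_def by auto
  obtain G where G: "G \<in> carrier_mat n m" "G * L = 1\<^sub>m n"
    using minimal_basis_left_inverse[OF min L] by blast
  have skew: "P\<^sup>T = - P" using P by (simp add: skew_symmetric_matpoly_iff)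
  have image: "image_mat (fract_mat P) = image_mat (fract_mat L)"
    using min polynomial_basis_cols_iff[OF L] unfolding minimal_basis_def Col_eq_image_mat by simp
  have F: "fract_mat P \<in> carrier_mat m m" "fract_mat L \<in> carrier_mat m n" "fract_mat G \<in> carrier_mat n m"
    using P L G by auto
  have GL: "fract_mat G * fract_mat L = 1\<^sub>m n"
    using to_fract_hom.mat_hom_mult[OF G(1) L] G(2) to_fract_hom.mat_hom_one by metis
  obtain Y where Y: "Y \<in> carrier_mat n m" "fract_mat P = fract_mat L * Y"
    using image_mat_subset_factor[OF F(1,2)] image by blast
  have "fract_mat (L * (G * P)) = fract_mat L * (fract_mat G * (fract_mat L * Y))"
    using L G P by (simp add: to_fract_hom.mat_hom_mult[of _ m n _ m] to_fract_hom.mat_hom_mult[of _ n m _ m] Y(2))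
  also have "\<dots> = fract_mat P"
    using F Y GL by (simp add: assoc_mult_mat[symmetric, of _ n m _ n _ m] del: assoc_mult_mat)
  finally have LGP: "L * (G * P) = P" by (rule to_fract_hom.mat_hom_inj)
  have "(L * (G * P))\<^sup>T = P\<^sup>T * G\<^sup>T * L\<^sup>T"
    using L G P by (subst transpose_mult[of _ m n _ m]) (auto simp: transpose_mult[of _ n m _ m])
  then have "- P = - P * G\<^sup>T * L\<^sup>T" unfolding LGP skew .
  also have "\<dots> = - (P * G\<^sup>T * L\<^sup>T)" using P(1) G(1) L by simp
  finally have PGL: "P * G\<^sup>T * L\<^sup>T = P" by (metis uminus_uminus_mat)
  define E where "E = G * P * G\<^sup>T"
  have E: "E \<in> carrier_mat n n" using G P by (auto simp: E_def)
  have "L * E * L\<^sup>T = L * (G * P) * G\<^sup>T * L\<^sup>T"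
    unfolding E_def using L G P
    by (simp add: assoc_mult_mat[of _ m n _ m _ n] assoc_mult_mat[of _ n m _ m _ n])
  then have fact: "P = L * E * L\<^sup>T" using LGP PGL by simp
  obtain Z where Z: "Z \<in> carrier_mat m n" "fract_mat L = fract_mat P * Z"
    using image_mat_subset_factor[OF F(2,1)] image by blast
  have FE: "fract_mat E \<in> carrier_mat n n" "fract_mat L\<^sup>T \<in> carrier_mat n m" using E L by auto
  have "fract_mat P = fract_mat L * (fract_mat E * fract_mat L\<^sup>T)"
    using L E by (subst fact) (simp add: to_fract_hom.mat_hom_mult[of _ m n _ m] to_fract_hom.mat_hom_mult[of _ n n _ m])
  then have "1\<^sub>m n = fract_mat G * (fract_mat L * (fract_mat E * fract_mat L\<^sup>T) * Z)"
    using GL Z(2) by simp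
  also have "\<dots> = (fract_mat G * fract_mat L) * (fract_mat E * (fract_mat L\<^sup>T * Z))"
    using F FE Z(1)
    by (simp add: assoc_mult_mat[of _ n m _ n _ n] assoc_mult_mat[of _ m n _ m _ n] assoc_mult_mat[of _ n n _ m _ n])
  also have "\<dots> = fract_mat E * (fract_mat L\<^sup>T * Z)"
    unfolding GL using FE Z(1) by (intro left_mult_one_mat[of _ n n]) auto
  finally have one: "fract_mat E * (fract_mat L\<^sup>T * Z) = 1\<^sub>m n" by (rule sym)
  have "det (fract_mat E) * det (fract_mat L\<^sup>T * Z) = 1"
    using det_mult[OF FE(1) mult_carrier_mat[OF FE(2) Z(1)]] unfolding one det_one by (rule sym)
  then have "det (fract_mat E) \<noteq> 0" by auto
  then have "vec_space.rank n (fract_mat E) = n" using vec_space.det_rank_iff[OF FE(1)] by blast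
  then have "normal_rank E = n" using E by (simp add: normal_rank_def)
  moreover have "skew_symmetric_matpoly E"
    using skew_congruence[OF P(1) skew G(1)] E by (simp add: skew_symmetric_matpoly_iff E_def)
  ultimately show ?thesis
    unfolding skew_factorization_def n_def[symmetric] using L E fact min by blast
qed

section \<open>Degrees of a minimal basis\<close>

lemma coeff_prod_degree_le:
  fixes f :: "'b \<Rightarrow> 'a :: comm_ring_1 poly"
  assumes "finite A" "\<And>i. i \<in> A \<Longrightarrow> degree (f i) \<le> k i"
  shows "coeff (\<Prod>i\<in>A. f i) (\<Sum>i\<in>A. k i) = (\<Prod>i\<in>A. coeff (f i) (k i))"
  using assms
proof (induction A rule: finite_induct)
  case (insert x A)
  have "degree (\<Prod>i\<in>A. f i) \<le> (\<Sum>i\<in>A. degree (f i))"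
    using degree_prod_sum_le[OF insert.hyps(1), of f] by (simp add: o_def)
  also have "\<dots> \<le> (\<Sum>i\<in>A. k i)" using insert.prems by (intro sum_mono) auto
  finally have "coeff (f x * (\<Prod>i\<in>A. f i)) (k x + (\<Sum>i\<in>A. k i)) = coeff (f x) (k x) * coeff (\<Prod>i\<in>A. f i) (\<Sum>i\<in>A. k i)"
    using insert.prems by (intro coeff_mult_degree_le) auto
  then show ?case using insert by simp
qed simp

text \<open>With \<open>D = diag (\<lambda>^(\<delta> i))\<close>, the matrix \<open>D E D\<close> has degree at most \<open>d\<close>, and \<open>F\<close> is its
  coefficient at \<open>\<lambda>^d\<close>.\<close>

lemma coeff_det_graded:
  fixes E :: "'a :: comm_ring_1 poly mat"
  assumes E: "E \<in> carrier_mat n n"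
    and deg: "\<And>i j. i < n \<Longrightarrow> j < n \<Longrightarrow> E $$ (i, j) \<noteq> 0 \<Longrightarrow> \<delta> i + \<delta> j + degree (E $$ (i, j)) \<le> d"
    and F: "F = mat n n (\<lambda>(i, j). if \<delta> i + \<delta> j \<le> d then coeff (E $$ (i, j)) (d - (\<delta> i + \<delta> j)) else 0)"
  shows "coeff (det E) (n * d - 2 * (\<Sum>i<n. \<delta> i)) = det F"
proof -
  let ?N = "n * d - 2 * (\<Sum>i<n. \<delta> i)"
  have Fc: "F \<in> carrier_mat n n" by (simp add: F)
  have "coeff (signof p * (\<Prod>i = 0..<n. E $$ (i, p i))) ?N = signof p * (\<Prod>i = 0..<n. F $$ (i, p i))"
    if p: "p permutes {0..<n}" for p
  proof -
    have pn: "p i < n" if "i < n" for i using permutes_in_image[OF p, of i] that by simp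
    have "coeff (\<Prod>i = 0..<n. E $$ (i, p i)) ?N = (\<Prod>i = 0..<n. F $$ (i, p i))"
    proof (cases "\<exists>i<n. E $$ (i, p i) = 0")
      case True
      then obtain i where "i < n" "E $$ (i, p i) = 0" by blast
      then have "(\<Prod>i = 0..<n. E $$ (i, p i)) = 0" "(\<Prod>i = 0..<n. F $$ (i, p i)) = 0"
        using pn[of i] by (auto intro!: prod_zero bexI[of _ i] simp: F simp del: prod_zero_iff)
      then show ?thesis by simp
    next
      case False
      then have le: "\<delta> i + \<delta> (p i) + degree (E $$ (i, p i)) \<le> d" if "i < n" for i
        using deg[OF that pn[OF that]] that by auto
      have "(\<Sum>i = 0..<n. \<delta> (p i)) = (\<Sum>i = 0..<n. \<delta> i)"
        using sum.permute[OF p, of \<delta>] by (simp add: o_def)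
      then have two: "(\<Sum>i = 0..<n. \<delta> i + \<delta> (p i)) = 2 * (\<Sum>i<n. \<delta> i)"
        by (simp add: sum.distrib atLeast0LessThan)
      have "(\<Sum>i = 0..<n. d - (\<delta> i + \<delta> (p i))) = (\<Sum>i = 0..<n. d) - (\<Sum>i = 0..<n. \<delta> i + \<delta> (p i))"
        using le by (intro sum_subtractf_nat) fastforce
      then have N: "?N = (\<Sum>i = 0..<n. d - (\<delta> i + \<delta> (p i)))" using two by simp
      have "coeff (\<Prod>i = 0..<n. E $$ (i, p i)) ?N = (\<Prod>i = 0..<n. coeff (E $$ (i, p i)) (d - (\<delta> i + \<delta> (p i))))"
        unfolding N using le by (intro coeff_prod_degree_le) fastforce+
      also have "\<dots> = (\<Prod>i = 0..<n. F $$ (i, p i))"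
      proof (rule prod.cong[OF refl])
        fix i assume "i \<in> {0..<n}"
        then show "coeff (E $$ (i, p i)) (d - (\<delta> i + \<delta> (p i))) = F $$ (i, p i)"
          using pn[of i] le[of i] by (simp add: F)
      qed
      finally show ?thesis .
    qed
    then show ?thesis by (cases p rule: sign_cases) auto
  qed
  then show ?thesis unfolding det_def'[OF E] det_def'[OF Fc] coeff_sum by simp
qed

lemma det_nonzero_perm:
  assumes "(A :: 'a :: comm_ring_1 mat) \<in> carrier_mat n n" "det A \<noteq> 0"
  obtains p where "p permutes {0..<n}" "\<And>i. i < n \<Longrightarrow> A $$ (i, p i) \<noteq> 0"
proof -
  obtain p where p: "p permutes {0..<n}" "signof p * (\<Prod>i = 0..<n. A $$ (i, p i)) \<noteq> 0"
    using assms(2) sum.neutral[of "{p. p permutes {0..<n}}" "\<lambda>p. signof p * (\<Prod>i = 0..<n. A $$ (i, p i))"]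
    unfolding det_def'[OF assms(1)] by blast
  have "A $$ (i, p i) \<noteq> 0" if "i < n" for i
  proof
    assume "A $$ (i, p i) = 0"
    then have "(\<Prod>i = 0..<n. A $$ (i, p i)) = 0" using that by (intro prod_zero) auto
    then show False using p(2) by simp
  qed
  then show ?thesis using that p by blast
qed

lemma antimono_perm_sum:
  fixes \<delta> :: "nat \<Rightarrow> nat"
  assumes anti: "\<And>i j. i \<le> j \<Longrightarrow> j < n \<Longrightarrow> \<delta> j \<le> \<delta> i"
    and p: "p permutes {0..<n}" and le: "\<And>i. i < n \<Longrightarrow> \<delta> i + \<delta> (p i) \<le> d"
    and sum: "n * d \<le> 2 * (\<Sum>i<n. \<delta> i)" and i: "i < n"
  shows "\<delta> i + \<delta> (n - 1 - i) = d"
proof -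
  have le_rev: "\<delta> i + \<delta> (n - 1 - i) \<le> d" if i: "i < n" for i
  proof -
    have "\<exists>k \<le> i. p k \<le> n - 1 - i"
    proof (rule ccontr)
      assume "\<not> ?thesis"
      then have "p ` {..i} \<subseteq> {n - i..<n}"
        using permutes_in_image[OF p] i by force
      then have "card (p ` {..i}) \<le> card {n - i..<n}" by (intro card_mono) auto
      moreover have "card (p ` {..i}) = Suc i"
        using permutes_inj_on[OF p] by (simp add: card_image)
      ultimately show False using i by simp
    qed
    then obtain k where k: "k \<le> i" "p k \<le> n - 1 - i" by blast
    then have "\<delta> i \<le> \<delta> k" "\<delta> (n - 1 - i) \<le> \<delta> (p k)" using anti i by auto
    then show ?thesis using le[of k] k i by linarith
  qed
  have "(\<Sum>i<n. \<delta> (n - Suc i)) = (\<Sum>i<n. \<delta> i)" by (rule sum.nat_diff_reindex)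
  then have two: "(\<Sum>i<n. \<delta> i + \<delta> (n - 1 - i)) = 2 * (\<Sum>i<n. \<delta> i)"
    by (simp add: sum.distrib)
  show ?thesis
  proof (rule ccontr)
    assume "\<not> ?thesis"
    then have "\<delta> i + \<delta> (n - 1 - i) < d" using le_rev[OF i] by simp
    then have "(\<Sum>i<n. \<delta> i + \<delta> (n - 1 - i)) < (\<Sum>i<n. d)"
      using le_rev i by (intro sum_strict_mono_ex1) auto
    then show False using sum two by simp
  qed
qed

lemma coeff_mat_degree_less:
  assumes "mat_degree A < k" shows "mat_coeff A k = 0\<^sub>m (dim_row A) (dim_col A)"
proof (rule ccontr)
  assume "mat_coeff A k \<noteq> 0\<^sub>m (dim_row A) (dim_col A)"
  then have "k \<le> mat_degree A"
    unfolding mat_degree_def using finite_mat_coeff_nonzero by (intro Max_ge) auto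
  then show False using assms by simp
qed

lemma degree_le_mat_degree:
  assumes "i < dim_row A" "j < dim_col A" shows "degree (A $$ (i, j)) \<le> mat_degree A"
proof (rule degree_le, intro allI impI)
  fix k assume "mat_degree A < k"
  from coeff_mat_degree_less[OF this] assms show "coeff (A $$ (i, j)) k = 0"
    by (auto simp: mat_coeff_def mat_eq_iff)
qed

lemma poly_rev_poly_0: "poly (rev_poly d p) 0 = coeff p d"
proof -
  have "poly (rev_poly d p) 0 = (\<Sum>i\<le>d. if i = d then coeff p i else 0)"
    unfolding rev_poly_def poly_sum by (intro sum.cong) (auto simp: poly_monom)
  then show ?thesis by simp
qed

lemma poly_mat_mult:
  fixes A B :: "'a :: comm_ring_1 poly mat"
  assumes "A \<in> carrier_mat a b" "B \<in> carrier_mat b c"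
  shows "map_mat (\<lambda>p. poly p x) (A * B) = map_mat (\<lambda>p. poly p x) A * map_mat (\<lambda>p. poly p x) B"
  using assms by (intro eq_matI) (auto simp: scalar_prod_def poly_sum)

lemma det_map_mat_poly:
  "det (map_mat (\<lambda>p. poly p x) A) = poly (det (A :: 'a :: comm_ring_1 poly mat)) x"
  by (rule comm_ring_hom.hom_det) (unfold_locales, auto)

lemma mat_coeff_graded_congruence:
  assumes L: "L \<in> carrier_mat m n" and E: "E \<in> carrier_mat n n"
    and degL: "\<And>a i. a < m \<Longrightarrow> i < n \<Longrightarrow> degree (L $$ (a, i)) \<le> \<delta> i"
    and degE: "\<And>i j. i < n \<Longrightarrow> j < n \<Longrightarrow> E $$ (i, j) \<noteq> 0 \<Longrightarrow> \<delta> i + \<delta> j + degree (E $$ (i, j)) \<le> d"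
    and F: "F = mat n n (\<lambda>(i, j). if \<delta> i + \<delta> j \<le> d then coeff (E $$ (i, j)) (d - (\<delta> i + \<delta> j)) else 0)"
    and H: "H = mat m n (\<lambda>(a, i). coeff (L $$ (a, i)) (\<delta> i))"
  shows "mat_coeff (L * E * L\<^sup>T) d = H * F * H\<^sup>T"
proof (rule eq_matI)
  have Fc: "F \<in> carrier_mat n n" and Hc: "H \<in> carrier_mat m n" by (simp_all add: F H)
  fix a b assume "a < dim_row (H * F * H\<^sup>T)" "b < dim_col (H * F * H\<^sup>T)"
  then have ab: "a < m" "b < m" using Hc by auto
  have triple: "(X * Y * X\<^sup>T) $$ (a, b) = (\<Sum>j<n. \<Sum>i<n. X $$ (a, i) * Y $$ (i, j) * X $$ (b, j))"
    if "X \<in> carrier_mat m n" "Y \<in> carrier_mat n n" for X Y :: "'b :: comm_ring_1 mat"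
    using that ab by (simp add: scalar_prod_def atLeast0LessThan sum_distrib_right del: assoc_mult_mat)
  have "coeff (L $$ (a, i) * E $$ (i, j) * L $$ (b, j)) d = H $$ (a, i) * F $$ (i, j) * H $$ (b, j)"
    if ij: "i < n" "j < n" for i j
  proof (cases "E $$ (i, j) = 0")
    case True then show ?thesis using ij by (simp add: F)
  next
    case False
    note le = degE[OF ij False]
    have 1: "degree (E $$ (i, j)) \<le> d - (\<delta> i + \<delta> j)" using le by simp
    have "coeff (L $$ (a, i) * E $$ (i, j) * L $$ (b, j)) ((\<delta> i + (d - (\<delta> i + \<delta> j))) + \<delta> j)
      = coeff (L $$ (a, i)) (\<delta> i) * coeff (E $$ (i, j)) (d - (\<delta> i + \<delta> j)) * coeff (L $$ (b, j)) (\<delta> j)"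
      using coeff_mult_degree_le[OF degL[OF ab(1) ij(1)] 1] degL[OF ab(1) ij(1)] degL[OF ab(2) ij(2)] 1
      by (subst coeff_mult_degree_le) (auto intro: order_trans[OF degree_mult_le] add_mono)
    moreover have "(\<delta> i + (d - (\<delta> i + \<delta> j))) + \<delta> j = d" using le by simp
    ultimately show ?thesis using ij ab le by (simp add: F H)
  qed
  then have "coeff ((L * E * L\<^sup>T) $$ (a, b)) d = (H * F * H\<^sup>T) $$ (a, b)"
    unfolding triple[OF L E] triple[OF Hc Fc] coeff_sum by (intro sum.cong refl) auto
  then show "mat_coeff (L * E * L\<^sup>T) d $$ (a, b) = (H * F * H\<^sup>T) $$ (a, b)"
    unfolding mat_coeff_def using ab L by (subst index_map_mat) auto
qed (use L in \<open>auto simp: mat_coeff_def H\<close>)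

lemma minimal_basis_degree_middle:
  assumes min: "minimal_basis m V (cols L)" and L: "L \<in> carrier_mat m n" and E: "E \<in> carrier_mat n n"
    and deg: "mat_degree (L * E * L\<^sup>T) \<le> d" and ij: "i < n" "j < n" "E $$ (i, j) \<noteq> 0"
  shows "vec_degree (col L i) + vec_degree (col L j) + degree (E $$ (i, j)) \<le> d"
proof -
  define X where "X = E * L\<^sup>T"
  have X: "X \<in> carrier_mat n m" using E L by (auto simp: X_def)
  have LX: "L * X = L * E * L\<^sup>T" using L E by (simp add: X_def)
  have 1: "0 + vec_degree (col L k) + degree (X $$ (k, b)) \<le> d"
    if kb: "k < n" "b < m" "X $$ (k, b) \<noteq> 0" for k b
  proof -
    have "0 + vec_degree (col L k) + degree (col X b $ k) \<le> d"
    proof (rule minimal_basis_predictable_degree[OF min L])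
      fix a assume a: "a < m"
      have "(L *\<^sub>v col X b) $ a = (L * X) $$ (a, b)" using L X a kb by simp
      then show "0 + degree ((L *\<^sub>v col X b) $ a) \<le> d"
        using degree_le_mat_degree[of a "L * X" b] deg L X a kb(2) unfolding LX[symmetric] by auto
    qed (use X kb in auto)
    then show ?thesis using X kb by simp
  qed
  have XT: "X\<^sup>T = L * E\<^sup>T" unfolding X_def using transpose_mult[OF E, of "L\<^sup>T" m] L by simp
  have "vec_degree (col L i) + vec_degree (col L j) + degree (row E i $ j) \<le> d"
  proof (rule minimal_basis_predictable_degree[OF min L])
    fix a assume a: "a < m" and nz: "(L *\<^sub>v row E i) $ a \<noteq> 0"
    have "(L *\<^sub>v row E i) $ a = (L * E\<^sup>T) $$ (a, i)" using L E a ij by simp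
    also have "\<dots> = X $$ (i, a)" unfolding XT[symmetric] using X a ij by simp
    finally show "vec_degree (col L i) + degree ((L *\<^sub>v row E i) $ a) \<le> d"
      using 1[OF ij(1) a] nz by simp
  qed (use E ij in auto)
  then show ?thesis using E ij by simp
qed

lemma not_finite_eigenvalue_smith:
  assumes "\<not> finite_eigenvalue A \<alpha>" "smith_form A S" "i < dim_row S" "i < dim_col S" "S $$ (i, i) \<noteq> 0"
  shows "poly (S $$ (i, i)) \<alpha> \<noteq> 0"
  using assms unfolding finite_eigenvalue_def invariant_polynomial_def
  by (metis min_less_iff_conj)

lemma minimal_basis_degree_pairing:
  assumes P: "P \<in> carrier_mat m m" "mat_degree P \<le> d"
    and fin: "\<And>\<alpha>. \<not> finite_eigenvalue P \<alpha>" and inf: "\<not> infinite_eigenvalue d P"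
    and L: "L \<in> carrier_mat m n" and E: "E \<in> carrier_mat n n" "det E \<noteq> 0" and PLE: "P = L * E * L\<^sup>T"
    and min: "minimal_basis m V (cols L)"
    and anti: "\<And>i j. i \<le> j \<Longrightarrow> j < n \<Longrightarrow> vec_degree (col L j) \<le> vec_degree (col L i)"
    and k: "k < n"
  shows "vec_degree (col L k) + vec_degree (col L (n - 1 - k)) = d"
proof -
  obtain G where G: "G \<in> carrier_mat n m" "G * L = 1\<^sub>m n"
    using minimal_basis_left_inverse[OF min L] by blast
  have LG: "L\<^sup>T * G\<^sup>T = 1\<^sub>m n" using transpose_mult[OF G(1) L] G(2) by simp
  have "G * P * G\<^sup>T = (G * L) * E * (L\<^sup>T * G\<^sup>T)"
    unfolding PLE using G(1) L E(1)
    by (simp add: assoc_mult_mat[of _ n m _ m _ n] assoc_mult_mat[of _ m n _ m _ n] assoc_mult_mat[of _ m n _ n _ n]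
        assoc_mult_mat[of _ n m _ n _ n] assoc_mult_mat[of _ m n _ n _ m] assoc_mult_mat[of _ n n _ m _ n])
  then have GPG: "E = G * P * G\<^sup>T" using G(2) LG E(1) by simp
  have smith: "(\<forall>i<n. i < m \<and> S $$ (i, i) \<noteq> 0)"
    if S: "smith_form A S" and A: "A \<in> carrier_mat m m"
      and nz: "det (G * A * G\<^sup>T) \<noteq> 0" for A S
  proof -
    obtain U W where UW: "U \<in> carrier_mat m m" "W \<in> carrier_mat m m"
      "invertible_mat U" "invertible_mat W" "S = U * A * W"
      using S A unfolding smith_form_def by auto
    obtain U' where U': "U' \<in> carrier_mat m m" "U' * U = 1\<^sub>m m"
      using unimodular_inverse[OF UW(1)] UW invertible_mat_iff_det_dvd_1 by blast
    obtain W' where W': "W' \<in> carrier_mat m m" "W * W' = 1\<^sub>m m"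
      using unimodular_inverse[OF UW(2)] UW invertible_mat_iff_det_dvd_1 by blast
    have Sc: "S \<in> carrier_mat m m" using UW A by auto
    have "U' * S * W' = (U' * U) * A * (W * W')"
      unfolding UW(5) using U'(1) W'(1) UW(1,2) A by (simp add: assoc_mult_mat[of _ m m _ m _ m])
    then have "A = U' * S * W'" using U' W' A by simp
    then have GAG: "G * A * G\<^sup>T = (G * U') * S * (W' * G\<^sup>T)"
      using G(1) U'(1) W'(1) Sc
      by (simp add: assoc_mult_mat[of _ m m _ m _ m] assoc_mult_mat[of _ n m _ m _ m] assoc_mult_mat[of _ m m _ m _ n]
          assoc_mult_mat[of _ n m _ m _ n])
    have X: "G * U' \<in> carrier_mat n m" and Y: "W' * G\<^sup>T \<in> carrier_mat m n"
      using G(1) U'(1) W'(1) by auto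
    have diag: "diagonal_mat S" using S unfolding smith_form_def by blast
    have chain: "S $$ (Suc i, Suc i) = 0" if "Suc i < min m m" "S $$ (i, i) = 0" for i
    proof -
      have "S $$ (i, i) dvd S $$ (Suc i, Suc i)" using S Sc that(1) unfolding smith_form_def by auto
      then show ?thesis using that(2) by simp
    qed
    show ?thesis
      using smith_diag_nonzero(1,3)[OF X Sc Y diag chain nz[unfolded GAG]] by blast
  qed
  have "det E dvd 1"
  proof -
    obtain S where S: "smith_form P S" using smith_form_exists by blast
    then obtain U W where UW: "U \<in> carrier_mat m m" "W \<in> carrier_mat m m" "S = U * P * W"
      using P(1) unfolding smith_form_def by auto
    have Sc: "S \<in> carrier_mat m m" using UW P by auto
    have nz: "i < m \<and> S $$ (i, i) \<noteq> 0" if "i < n" for i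
      using smith[OF S P(1)] E(2) GPG that by simp
    then have nm: "n \<le> m" by (meson not_le_imp_less order_less_irrefl)
    have one: "S $$ (i, i) = 1" if i: "i < n" for i
    proof -
      have "poly (S $$ (i, i)) z \<noteq> 0" for z
        using not_finite_eigenvalue_smith[OF fin S] nz[OF i] Sc by auto
      then have "constant (poly (S $$ (i, i)))" using fundamental_theorem_of_algebra by blast
      then have "degree (S $$ (i, i)) = 0" by (simp add: constant_degree)
      moreover have "lead_coeff (S $$ (i, i)) = 1" using S Sc nz[OF i] unfolding smith_form_def by auto
      ultimately show ?thesis by (metis degree_eq_zeroE lead_coeff_pCons(2) one_pCons)
    qed
    have "S = (U * L) * E * (L\<^sup>T * W)"
      unfolding UW(3) PLE using UW(1,2) L E(1)
      by (simp add: assoc_mult_mat[of _ m m _ m _ m] assoc_mult_mat[of _ m n _ m _ m] assoc_mult_mat[of _ m m _ n _ m]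
          assoc_mult_mat[of _ m n _ n _ m] assoc_mult_mat[of _ n n _ m _ m] assoc_mult_mat[of _ m m _ n _ n]
          assoc_mult_mat[of _ m n _ n _ n])
    moreover have "diagonal_mat S" using S unfolding smith_form_def by blast
    ultimately obtain x y where "(\<Prod>i<n. S $$ (i, i)) = x * det E * y"
      using det_top_left_block[of "U * L" m n E "L\<^sup>T * W"] UW L E nm by auto
    then have "1 = x * det E * y" using one by simp
    then show ?thesis by (metis dvd_mult2 dvd_triv_right)
  qed
  then have deg_det: "degree (det E) = 0" by (simp add: is_unit_iff_degree)
  let ?\<delta> = "\<lambda>j. vec_degree (col L j)"
  have degE: "?\<delta> i + ?\<delta> j + degree (E $$ (i, j)) \<le> d" if "i < n" "j < n" "E $$ (i, j) \<noteq> 0" for i j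
    using minimal_basis_degree_middle[OF min L E(1)] P(2) PLE that by simp
  define F where "F = mat n n (\<lambda>(i, j). if ?\<delta> i + ?\<delta> j \<le> d then coeff (E $$ (i, j)) (d - (?\<delta> i + ?\<delta> j)) else 0)"
  define H where "H = mat m n (\<lambda>(a, i). coeff (L $$ (a, i)) (?\<delta> i))"
  have FH: "F \<in> carrier_mat n n" "H \<in> carrier_mat m n" by (simp_all add: F_def H_def)
  have lead: "mat_coeff P d = H * F * H\<^sup>T"
    unfolding PLE using degree_entry_le_vec_degree[OF L] degE
    by (intro mat_coeff_graded_congruence[OF L E(1) _ _ F_def H_def]) auto
  have "det F \<noteq> 0"
  proof -
    let ?R = "rev_mat d P"
    let ?ev = "\<lambda>x. map_mat (\<lambda>p. poly p x) :: complex poly mat \<Rightarrow> complex mat"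
    have R: "?R \<in> carrier_mat m m" using P by (simp add: rev_mat_def)
    obtain S where S: "smith_form ?R S" using smith_form_exists by blast
    then obtain U W where UW: "U \<in> carrier_mat m m" "W \<in> carrier_mat m m" "S = U * ?R * W"
      using R unfolding smith_form_def by auto
    have Sc: "S \<in> carrier_mat m m" using UW R by auto
    have "?ev 1 ?R = ?ev 1 P"
    proof (rule eq_matI)
      fix i j assume "i < dim_row (?ev 1 P)" "j < dim_col (?ev 1 P)"
      moreover from this have "degree (P $$ (i, j)) \<le> d"
        using degree_le_mat_degree[of i P j] P(2) by simp
      ultimately show "?ev 1 ?R $$ (i, j) = ?ev 1 P $$ (i, j)"
        using poly_rev_poly[of "P $$ (i, j)" d 1] by (simp add: rev_mat_def)
    qed (simp_all add: rev_mat_def)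
    then have "?ev 1 (G * ?R * G\<^sup>T) = ?ev 1 (G * P * G\<^sup>T)"
      using G(1) R P(1) by (simp add: poly_mat_mult[of _ n m _ m] poly_mat_mult[of _ n m _ n]
          poly_mat_mult[of _ m m _ n])
    moreover have "poly (det E) 1 \<noteq> 0"
      using deg_det E(2) by (metis degree_eq_zeroE pCons_0_0 poly_pCons mult_zero_right add_0_right poly_0)
    ultimately have "poly (det (G * ?R * G\<^sup>T)) 1 \<noteq> 0"
      by (metis GPG det_map_mat_poly)
    then have "det (G * ?R * G\<^sup>T) \<noteq> 0" by auto
    then have nz: "i < m \<and> S $$ (i, i) \<noteq> 0" if "i < n" for i using smith[OF S R] that by blast
    then have nm: "n \<le> m" by (meson not_le_imp_less order_less_irrefl)
    have nz0: "poly (S $$ (i, i)) 0 \<noteq> 0" if "i < n" for i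
      using not_finite_eigenvalue_smith[OF inf[unfolded infinite_eigenvalue_def] S] nz[OF that] Sc by auto
    have "?ev 0 ?R = mat_coeff P d"
      by (intro eq_matI) (auto simp: rev_mat_def mat_coeff_def poly_rev_poly_0)
    then have "?ev 0 S = ?ev 0 U * (H * F * H\<^sup>T) * ?ev 0 W"
      unfolding UW(3) lead[symmetric] using UW(1,2) R
      by (simp add: poly_mat_mult[of _ m m _ m] del: assoc_mult_mat)
    also have "\<dots> = (?ev 0 U * H) * F * (H\<^sup>T * ?ev 0 W)"
      using UW(1,2) FH
      by (simp add: assoc_mult_mat[of _ m m _ m _ m] assoc_mult_mat[of _ m n _ m _ m] assoc_mult_mat[of _ m m _ n _ m]
          assoc_mult_mat[of _ m n _ n _ m] assoc_mult_mat[of _ n n _ m _ m] assoc_mult_mat[of _ m m _ n _ n]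
          assoc_mult_mat[of _ m n _ n _ n])
    finally have evS: "?ev 0 S = (?ev 0 U * H) * F * (H\<^sup>T * ?ev 0 W)" .
    have "diagonal_mat (?ev 0 S)"
      using S Sc unfolding smith_form_def diagonal_mat_def by auto
    note D = this[unfolded evS]
    have X: "?ev 0 U * H \<in> carrier_mat m n" and Y: "H\<^sup>T * ?ev 0 W \<in> carrier_mat n m"
      using UW(1,2) FH by auto
    obtain x y where xy: "(\<Prod>i<n. ?ev 0 S $$ (i, i)) = x * det F * y"
      unfolding evS by (rule det_top_left_block[OF X FH(1) Y nm D])
    have "(\<Prod>i<n. ?ev 0 S $$ (i, i)) \<noteq> 0" using nz0 nm Sc by simp
    then show ?thesis unfolding xy by auto
  qed
  then have "coeff (det E) (n * d - 2 * (\<Sum>i<n. ?\<delta> i)) \<noteq> 0"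
    using coeff_det_graded[OF E(1) degE F_def] by simp
  then have "n * d \<le> 2 * (\<Sum>i<n. ?\<delta> i)" using deg_det le_degree by fastforce
  moreover obtain p where "p permutes {0..<n}" "\<And>i. i < n \<Longrightarrow> E $$ (i, p i) \<noteq> 0"
    using det_nonzero_perm[OF E] by blast
  moreover have "?\<delta> i + ?\<delta> (p i) \<le> d" if "i < n" for i
    using degE[of i "p i"] that calculation permutes_in_image[of p "{0..<n}" i] by fastforce
  ultimately show ?thesis using antimono_perm_sum[of n ?\<delta> p d k] anti k by blast
qed

theorem lemma3p2:
  fixes m r d :: nat and P :: "complex poly mat"
  assumes "m > 0" and "r > 0"
  shows "(P \<in> POL_ss d (2 * r) m \<and> normal_rank P = 2 * r \<longrightarrow>
           (\<exists>L E. skew_factorization m r P L E))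
       \<and> (P \<in> POL_ss d (2 * r) m \<and> normal_rank P = 2 * r \<and> mat_degree P = d \<and>
           (\<forall>\<alpha>. \<not> finite_eigenvalue P \<alpha>) \<and> \<not> infinite_eigenvalue d P \<longrightarrow>
           (\<forall>L E. skew_factorization m r P L E \<and>
              (\<forall>i j. i \<le> j \<and> j < 2 * r \<longrightarrow> vec_degree (col L j) \<le> vec_degree (col L i)) \<longrightarrow>
              (\<forall>i < 2 * r. vec_degree (col L i) + vec_degree (col L (2 * r - 1 - i)) = d)))"
proof (intro conjI impI allI)
  assume "P \<in> POL_ss d (2 * r) m \<and> normal_rank P = 2 * r"
  then show "\<exists>L E. skew_factorization m r P L E"
    using skew_factorization_exists unfolding POL_ss_def by blast
next
  fix L E i
  assume P: "P \<in> POL_ss d (2 * r) m \<and> normal_rank P = 2 * r \<and> mat_degree P = d \<and>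
      (\<forall>\<alpha>. \<not> finite_eigenvalue P \<alpha>) \<and> \<not> infinite_eigenvalue d P"
    and LE: "skew_factorization m r P L E \<and>
      (\<forall>i j. i \<le> j \<and> j < 2 * r \<longrightarrow> vec_degree (col L j) \<le> vec_degree (col L i))"
    and i: "i < 2 * r"
  have E: "E \<in> carrier_mat (2 * r) (2 * r)" "normal_rank E = 2 * r"
    using LE unfolding skew_factorization_def by auto
  then have "det (fract_mat E) \<noteq> 0"
    using vec_space.det_rank_iff[of "fract_mat E" "2 * r"] unfolding normal_rank_def by auto
  then have "det E \<noteq> 0" by auto
  then show "vec_degree (col L i) + vec_degree (col L (2 * r - 1 - i)) = d"
    using minimal_basis_degree_pairing[of P m d L "2 * r" E "Col P" i] P LE i
    unfolding skew_factorization_def POL_ss_def by auto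
qed

end
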